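(* Let $M\subseteq\mathbf{R}^m$ be a $C^2$ $n$-chain and let $F$ be a differentiable multivector valued function (with values in the geometric algebra of $\mathbf{R}^m$) defined on $M$. Then the tangential derivative $\nabla_V F$ exists (that is, the limit defining it exists and is invariant under coordinate changes). Moreover, for a $C^2$ singular $n$-cube $\varphi$ of $M$ and a point $x_0\in(0,1)^n$, $$\nabla_V F(\varphi(x_0))=\sum_{i=1}^n \frac{V^\dagger(\varphi(x_0))\,\varphi'(x_0,a_i)}{J(x_0)}\,\partial_i F(\varphi(x_0)),$$ where $a_i$ is the unit tangent $(n-1)$-vector to the oriented hyperplane $h_i$ through $x_0$ with normal vector $+e_i$, i.e. $a_i=v e_i=(-1)^{n-i}\,e_1\wedge\cdots\wedge\check e_i\wedge\cdots\wedge e_n$ ($e_i$ omitted).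
   Context: **Algebra.** Multivectors are elements of the geometric (Clifford) algebra of Euclidean $\mathbf{R}^m$ (so $u^2=|u|^2$ for vectors $u$); $\dagger$ denotes reversion and $|\cdot|$ the usual norm. Products are geometric products, and order matters. Let $e_1,\dots,e_n$ be the standard basis of $\mathbf{R}^n$ and $v=e_1\cdots e_n$ its unit positively oriented pseudoscalar. For fixed $x$ the differential $\varphi'(x,\cdot)$ is extended to multivectors as an outermorphism: $\varphi'(x,u_1\wedge\cdots\wedge u_k)=\varphi'(x,u_1)\wedge\cdots\wedge\varphi'(x,u_k)$. **Chains.** A $C^2$ singular $n$-cube is a continuous map $\varphi:[0,1]^n\to M\subseteq\mathbf{R}^m$ that is $C^2$ on $(0,1)^n$, with Jacobian $J(x)=|\varphi'(x,v)|>0$. A $C^2$ $n$-chain is a finite formal integer combination of such cubes, and notions at points of $M$ are understood cube by cube. $V(X)$ is the tangent to $M$ at $X$, i.e. the unit positively oriented pseudoscalar of the tangent algebra to $M$ at $X$; for $X=\varphi(x)$, $\varphi'(x,v)=J(x)V(X)$. $F$ differentiable means that $F\circ\varphi$ is differentiable, and $\partial_iF(\varphi(x_0))$ denotes $\partial (F\circ\varphi)/\partial x_i$ at $x_0$. **Directed boundary integrals.** For a closed cube $c$ and $C=\varphi(c)$, $\int_{\partial C}dA\,F=\int_{\partial c}|da|\,\varphi'(x,a)\,F(\varphi(x))$ (a componentwise Lebesgue integral), where $|da|$ is $(n-1)$-volume on $\partial c$ and $a=v\,\mathbf{n}$ is the tangent to $\partial c$, with $\mathbf{n}$ the outward unit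 normal to $c$. **Tangential derivative.** For $X=\varphi(x)$, $$\nabla_V F(X)=V^\dagger(X)\lim_{x\in c,\ \mathrm{diam}(c)\to0}\frac{1}{|C|}\int_{\partial C}dA\,F=\frac{V^\dagger(X)}{J(x)}\lim_{x\in c,\ \mathrm{diam}(c)\to 0}\frac1{|c|}\int_{\partial C}dA\,F ,$$ where $c\subseteq[0,1]^n$ ranges over closed cubes (sides parallel to the axes) containing $x$, $C=\varphi(c)$, and $|\cdot|$ denotes $n$-volume. **Invariance under coordinate changes** means: if $\psi$ is a second $C^2$ singular $n$-cube parametrizing $M$ about the same point $X=\psi(y_0)=\varphi(x_0)$ with the same orientation, so that $g=\varphi^{-1}\circ\psi$ is an orientation-preserving change of coordinates near $y_0$, then computing $\nabla_V F(X)$ with $\psi$ gives the same value as with $\varphi$. *)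

theory Defs
  imports "HOL-Analysis.Analysis" "HOL-Library.Poly_Mapping"
begin

section \<open>The geometric algebra of Euclidean space\<close>

text \<open>
  A multivector of the geometric algebra of \<open>real ^ 'a\<close> is given by its coordinates with respect to
  the \<open>2 ^ CARD('a)\<close> basis blades \<open>e\<^sub>S = e\<^sub>i \<dots> e\<^sub>j\<close> (\<open>S = {i < \<dots> < j}\<close>).  These blades are orthonormal
  for the usual norm of multivectors, which is therefore the Euclidean norm of the coordinates.  The
  product that the library puts on \<open>real ^ 'b\<close> is the componentwise one and is not used here.
\<close>

type_synonym 'n point = "(real, 'n) vec"

type_synonym 'a multivector = "real ^ ('a set)"

definition blade :: "'a::finite set \<Rightarrow> 'a multivector" where
  "blade S = axis S 1"

definition gvec :: "'a::finite point \<Rightarrow> 'a multivector" where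
  "gvec u = (\<Sum>i\<in>UNIV. (u $ i) *\<^sub>R blade {i})"

text \<open>One sign for each transposition needed to sort the word \<open>e\<^sub>S e\<^sub>T\<close>.\<close>

definition blade_sign :: "'a::{finite,linorder} set \<Rightarrow> 'a set \<Rightarrow> real" where
  "blade_sign S T = (\<Prod>s\<in>S. \<Prod>t\<in>T. if t < s then - 1 else 1)"

definition gprod :: "'a::{finite,linorder} multivector \<Rightarrow> 'a multivector \<Rightarrow> 'a multivector"
    (infixl "\<odot>" 70) where
  "A \<odot> B = (\<Sum>S\<in>UNIV. \<Sum>T\<in>UNIV. (A $ S * B $ T * blade_sign S T) *\<^sub>R blade (sym_diff S T))"

definition outer :: "'a::{finite,linorder} multivector \<Rightarrow> 'a multivector \<Rightarrow> 'a multivector"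
    (infixl "\<curlywedge>" 70) where
  "A \<curlywedge> B = (\<Sum>S\<in>UNIV. \<Sum>T\<in>UNIV.
      (if S \<inter> T = {} then A $ S * B $ T * blade_sign S T else 0) *\<^sub>R blade (S \<union> T))"

definition gprod_list :: "'a::{finite,linorder} multivector list \<Rightarrow> 'a multivector" where
  "gprod_list As = foldr (\<odot>) As (blade {})"

definition outer_list :: "'a::{finite,linorder} multivector list \<Rightarrow> 'a multivector" where
  "outer_list As = foldr (\<curlywedge>) As (blade {})"

definition greverse :: "'a::finite multivector \<Rightarrow> 'a multivector" where
  "greverse A = (\<chi> S. (- 1) ^ (card S * (card S - 1) div 2) * A $ S)"

definition outermorphism ::
    "('n::{finite,linorder} point \<Rightarrow> 'm::{finite,linorder} point) \<Rightarrow> 'n multivector \<Rightarrow> 'm multivector" where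
  "outermorphism L A =
     (\<Sum>S\<in>UNIV. (A $ S) *\<^sub>R outer_list (map (\<lambda>i. gvec (L (axis i 1))) (sorted_list_of_set S)))"

definition unit_pseudoscalar :: "'n::{finite,linorder} multivector" where
  "unit_pseudoscalar = gprod_list (map (\<lambda>i. gvec (axis i 1)) (sorted_list_of_set UNIV))"

subsection \<open>The definitions have the expected properties\<close>

lemma multivector_eqI:
  fixes f g :: "'a::finite multivector \<Rightarrow> 'c::real_vector"
  assumes "linear f" "linear g" "\<And>S. f (blade S) = g (blade S)"
  shows "f A = g A"
proof -
  have "f = g"
    using assms by (intro linear_eq_stdbasis) (auto simp: Basis_vec_def blade_def)
  then show ?thesis by simp
qed

lemma linear_gprod_left: "linear (\<lambda>A. A \<odot> B)"
  by (rule linearI)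
    (simp_all add: gprod_def algebra_simps scaleR_sum_right sum.distrib)

lemma linear_gprod_right: "linear (\<lambda>B. A \<odot> B)"
  by (rule linearI)
    (simp_all add: gprod_def algebra_simps scaleR_sum_right sum.distrib)

lemma outer_alt: "A \<curlywedge> B = (\<Sum>S\<in>UNIV. \<Sum>T\<in>UNIV.
      (A $ S * B $ T * (if S \<inter> T = {} then blade_sign S T else 0)) *\<^sub>R blade (S \<union> T))"
  unfolding outer_def by (intro sum.cong refl) auto

lemma linear_outer_left: "linear (\<lambda>A. A \<curlywedge> B)"
  by (rule linearI)
    (simp_all only: outer_alt vector_add_component vector_scaleR_component real_scaleR_def algebra_simps scaleR_sum_right sum.distrib
       scaleR_scaleR scaleR_add_left)

lemma linear_outer_right: "linear (\<lambda>B. A \<curlywedge> B)"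
  by (rule linearI)
    (simp_all only: outer_alt vector_add_component vector_scaleR_component real_scaleR_def algebra_simps scaleR_sum_right sum.distrib
       scaleR_scaleR scaleR_add_left)

lemma blade_nth: "blade S $ T = (if T = S then 1 else 0)"
  by (simp add: blade_def axis_def)

lemma sum_blade:
  fixes f :: "'a::finite set \<Rightarrow> 'c::real_vector"
  shows "(\<Sum>T\<in>UNIV. (blade S $ T) *\<^sub>R f T) = f S"
proof -
  have "(\<Sum>T\<in>UNIV. (blade S $ T) *\<^sub>R f T) = (\<Sum>T\<in>UNIV. if T = S then f T else 0)"
    by (intro sum.cong refl) (simp add: blade_nth)
  then show ?thesis by simp
qed

lemma gvec_axis: "gvec (axis i 1) = blade {i}"
proof -
  have "gvec (axis i 1) = (\<Sum>j\<in>UNIV. if j = i then blade {j} else 0)"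
    unfolding gvec_def by (intro sum.cong refl) (simp add: axis_def)
  then show ?thesis by simp
qed

lemma linear_gvec: "linear gvec"
  by (rule linearI) (simp_all add: gvec_def algebra_simps sum.distrib scaleR_sum_right)

lemma gprod_blade: "blade S \<odot> blade T = blade_sign S T *\<^sub>R blade (sym_diff S T)"
proof -
  have "blade S \<odot> blade T = (\<Sum>S'\<in>UNIV. (blade S $ S') *\<^sub>R
      (\<Sum>T'\<in>UNIV. (blade T $ T') *\<^sub>R (blade_sign S' T' *\<^sub>R blade (sym_diff S' T'))))"
    by (simp add: gprod_def scaleR_sum_right mult.assoc)
  then show ?thesis by (simp only: sum_blade)
qed

lemma outer_blade:
  "blade S \<curlywedge> blade T = (if S \<inter> T = {} then blade_sign S T *\<^sub>R blade (S \<union> T) else 0)"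
proof -
  have "blade S \<curlywedge> blade T = (\<Sum>S'\<in>UNIV. (blade S $ S') *\<^sub>R
      (\<Sum>T'\<in>UNIV. (blade T $ T') *\<^sub>R ((if S' \<inter> T' = {} then blade_sign S' T' else 0) *\<^sub>R blade (S' \<union> T'))))"
    by (simp only: outer_alt scaleR_sum_right scaleR_scaleR mult.assoc)
  then show ?thesis by (simp only: sum_blade) simp
qed

lemma blade_sign_sym_diff_left: "blade_sign (sym_diff S T) U = blade_sign S U * blade_sign T U"
proof -
  define p where "p s = (\<Prod>t\<in>U. if t < s then - 1 else 1 :: real)" for s
  have sq: "p s * p s = 1" for s
    unfolding p_def prod.distrib[symmetric] by (rule prod.neutral) auto
  have *: "prod p X = prod p (X - Y) * prod p (X \<inter> Y)" for X Y
    by (subst prod.Int_Diff[of X p Y]) auto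
  have "prod p S * prod p T
      = prod p (S - T) * prod p (T - S) * (\<Prod>s\<in>S \<inter> T. p s * p s)"
    by (subst *[of S T], subst *[of T S]) (simp add: prod.distrib Int_commute)
  also have "\<dots> = prod p (sym_diff S T)"
    by (subst prod.union_disjoint) (auto simp: sq)
  finally show ?thesis by (simp add: blade_sign_def p_def)
qed

lemma blade_sign_sym_diff_right: "blade_sign S (sym_diff T U) = blade_sign S T * blade_sign S U"
proof -
  define p where "p t = (\<Prod>s\<in>S. if t < s then - 1 else 1 :: real)" for t
  have sw: "blade_sign S X = prod p X" for X
    unfolding blade_sign_def p_def by (rule prod.swap)
  have sq: "p s * p s = 1" for s
    unfolding p_def prod.distrib[symmetric] by (rule prod.neutral) auto
  have *: "prod p X = prod p (X - Y) * prod p (X \<inter> Y)" for X Y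
    by (subst prod.Int_Diff[of X p Y]) auto
  have "prod p T * prod p U
      = prod p (T - U) * prod p (U - T) * (\<Prod>s\<in>T \<inter> U. p s * p s)"
    by (subst *[of T U], subst *[of U T]) (simp add: prod.distrib Int_commute)
  also have "\<dots> = prod p (sym_diff T U)"
    by (subst prod.union_disjoint) (auto simp: sq)
  finally show ?thesis by (simp add: sw)
qed

lemma sym_diff_assoc: "sym_diff (sym_diff S T) U = sym_diff S (sym_diff T U)"
  by blast

lemma gprod_assoc: "(A \<odot> B) \<odot> C = A \<odot> (B \<odot> C)"
proof -
  note l = linear_compose[OF linear_gprod_left linear_gprod_left, unfolded o_def]
    linear_compose[OF linear_gprod_left linear_gprod_right, unfolded o_def]
    linear_compose[OF linear_gprod_right linear_gprod_left, unfolded o_def]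
    linear_compose[OF linear_gprod_right linear_gprod_right, unfolded o_def]
    linear_gprod_left linear_gprod_right
  have 1: "(blade S \<odot> blade T) \<odot> blade U = blade S \<odot> (blade T \<odot> blade U)"
    for S T U :: "'a set"
    by (simp add: gprod_blade linear_scale[OF linear_gprod_left]
        linear_scale[OF linear_gprod_right] blade_sign_sym_diff_left
        blade_sign_sym_diff_right sym_diff_assoc mult_ac del: Diff_Un)
  have 2: "(blade S \<odot> blade T) \<odot> C = blade S \<odot> (blade T \<odot> C)" for S T :: "'a set"
    by (rule multivector_eqI[of "\<lambda>C. (blade S \<odot> blade T) \<odot> C"]) (use l 1 in auto)
  have 3: "(blade S \<odot> B) \<odot> C = blade S \<odot> (B \<odot> C)" for S :: "'a set"
    by (rule multivector_eqI[of "\<lambda>B. (blade S \<odot> B) \<odot> C"]) (use l 2 in auto)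
  show ?thesis
    by (rule multivector_eqI[of "\<lambda>A. (A \<odot> B) \<odot> C"]) (use l 3 in auto)
qed

lemma gvec_square: "gvec u \<odot> gvec u = (u \<bullet> u) *\<^sub>R blade {}"
proof -
  have anti: "blade {i} \<odot> blade {j} + blade {j} \<odot> blade {i} = (if i = j then 2 else 0) *\<^sub>R blade {}"
    for i j :: 'a
    by (cases i j rule: linorder_cases)
      (auto simp: gprod_blade blade_sign_def insert_commute insert_Diff_if simp flip: scaleR_2)
  have e: "gvec u \<odot> gvec u = (\<Sum>i\<in>UNIV. \<Sum>j\<in>UNIV. (u $ i * u $ j) *\<^sub>R (blade {i} \<odot> blade {j}))"
    unfolding gvec_def
    by (simp add: linear_sum[OF linear_gprod_left] linear_sum[OF linear_gprod_right]
      linear_scale[OF linear_gprod_left] linear_scale[OF linear_gprod_right] scaleR_sum_right)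
      (subst sum.swap, simp add: mult.commute)
  also have "\<dots> = (\<Sum>i\<in>UNIV. \<Sum>j\<in>UNIV. (u $ i * u $ j) *\<^sub>R (blade {j} \<odot> blade {i}))"
    by (subst sum.swap) (simp add: mult.commute)
  finally have "2 *\<^sub>R (gvec u \<odot> gvec u) = (\<Sum>i\<in>UNIV. \<Sum>j\<in>UNIV.
      (u $ i * u $ j) *\<^sub>R (blade {i} \<odot> blade {j} + blade {j} \<odot> blade {i}))"
    by (simp add: scaleR_2 e scaleR_add_right sum.distrib)
  also have "\<dots> = (\<Sum>i\<in>UNIV. \<Sum>j\<in>UNIV. if i = j then (2 * (u $ i * u $ i)) *\<^sub>R blade {} else 0)"
    unfolding anti by (intro sum.cong refl) auto
  also have "\<dots> = 2 *\<^sub>R ((u \<bullet> u) *\<^sub>R blade {})"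
    by (simp add: inner_vec_def scaleR_sum_left scaleR_sum_right)
  finally show ?thesis by (simp only: scaleR_cancel_left) simp
qed

lemma outer_assoc: "(A \<curlywedge> B) \<curlywedge> C = A \<curlywedge> (B \<curlywedge> C)"
proof -
  note l = linear_compose[OF linear_outer_left linear_outer_left, unfolded o_def]
    linear_compose[OF linear_outer_left linear_outer_right, unfolded o_def]
    linear_compose[OF linear_outer_right linear_outer_left, unfolded o_def]
    linear_compose[OF linear_outer_right linear_outer_right, unfolded o_def]
    linear_outer_left linear_outer_right
  have u: "S \<union> T = sym_diff S T" if "S \<inter> T = {}" for S T :: "'a set"
    using that by blast
  have z: "0 \<curlywedge> X = 0" "X \<curlywedge> 0 = 0" for X :: "'a multivector"
    using linear_0[OF linear_outer_left] linear_0[OF linear_outer_right] by auto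
  have 1: "(blade S \<curlywedge> blade T) \<curlywedge> blade U = blade S \<curlywedge> (blade T \<curlywedge> blade U)"
    for S T U :: "'a set"
  proof (cases "S \<inter> T = {} \<and> S \<inter> U = {} \<and> T \<inter> U = {}")
    case True
    then have "blade_sign (S \<union> T) U = blade_sign S U * blade_sign T U"
      "blade_sign S (T \<union> U) = blade_sign S T * blade_sign S U"
      using blade_sign_sym_diff_left[of S T U] blade_sign_sym_diff_right[of S T U] u by metis+
    with True show ?thesis
      by (simp add: outer_blade linear_scale[OF linear_outer_left]
        linear_scale[OF linear_outer_right] Int_Un_distrib Int_Un_distrib2 Un_assoc mult_ac)
  next
    case False
    then show ?thesis
      by (auto simp: outer_blade linear_scale[OF linear_outer_left]
        linear_scale[OF linear_outer_right] Int_Un_distrib Int_Un_distrib2 z)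
  qed
  have 2: "(blade S \<curlywedge> blade T) \<curlywedge> C = blade S \<curlywedge> (blade T \<curlywedge> C)" for S T :: "'a set"
    by (rule multivector_eqI[of "\<lambda>C. (blade S \<curlywedge> blade T) \<curlywedge> C"]) (use l 1 in auto)
  have 3: "(blade S \<curlywedge> B) \<curlywedge> C = blade S \<curlywedge> (B \<curlywedge> C)" for S :: "'a set"
    by (rule multivector_eqI[of "\<lambda>B. (blade S \<curlywedge> B) \<curlywedge> C"]) (use l 2 in auto)
  show ?thesis
    by (rule multivector_eqI[of "\<lambda>A. (A \<curlywedge> B) \<curlywedge> C"]) (use l 3 in auto)
qed

lemma one_outer: "blade {} \<curlywedge> A = A"
  by (rule multivector_eqI[of "\<lambda>A. blade {} \<curlywedge> A"])
    (simp_all add: linear_outer_right outer_blade blade_sign_def linear_id[unfolded id_def])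

lemma outer_one: "A \<curlywedge> blade {} = A"
  by (rule multivector_eqI[of "\<lambda>A. A \<curlywedge> blade {}"])
    (simp_all add: linear_outer_left outer_blade blade_sign_def linear_id[unfolded id_def])

lemma outer_gvec_anticommute: "gvec u \<curlywedge> gvec w = - (gvec w \<curlywedge> gvec u)"
proof -
  have b: "blade {i} \<curlywedge> blade {j} = - (blade {j} \<curlywedge> blade {i})" for i j :: 'a
    by (cases i j rule: linorder_cases) (auto simp: outer_blade blade_sign_def insert_commute)
  have "gvec u \<curlywedge> gvec w = (\<Sum>i\<in>UNIV. \<Sum>j\<in>UNIV. (u $ i * w $ j) *\<^sub>R (blade {i} \<curlywedge> blade {j}))"
    unfolding gvec_def
    by (simp add: linear_sum[OF linear_outer_left] linear_sum[OF linear_outer_right]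
      linear_scale[OF linear_outer_left] linear_scale[OF linear_outer_right] scaleR_sum_right)
      (subst sum.swap, simp add: mult.commute)
  also have "\<dots> = - (\<Sum>i\<in>UNIV. \<Sum>j\<in>UNIV. (u $ i * w $ j) *\<^sub>R (blade {j} \<curlywedge> blade {i}))"
    by (subst b) (simp add: sum_negf)
  also have "(\<Sum>i\<in>UNIV. \<Sum>j\<in>UNIV. (u $ i * w $ j) *\<^sub>R (blade {j} \<curlywedge> blade {i})) = gvec w \<curlywedge> gvec u"
    unfolding gvec_def
    by (simp add: linear_sum[OF linear_outer_left] linear_sum[OF linear_outer_right]
      linear_scale[OF linear_outer_left] linear_scale[OF linear_outer_right] scaleR_sum_right mult.commute)
  finally show ?thesis .
qed

lemma outer_gvec_self: "gvec u \<curlywedge> gvec u = 0"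
  using outer_gvec_anticommute[of u u] by (simp add: eq_neg_iff_add_eq_0 flip: scaleR_2)

lemma sorted_list_of_set_insert_min:
  fixes b :: "'a::linorder"
  assumes "finite S" "\<forall>a\<in>S. b < a"
  shows "sorted_list_of_set (insert b S) = b # sorted_list_of_set S"
proof -
  have "b \<notin> S" using assms(2) by blast
  then have "sorted_list_of_set (insert b S) = insort b (sorted_list_of_set S)"
    using assms(1) by simp
  also have "\<dots> = b # sorted_list_of_set S"
    using assms by (intro insort_is_Cons) (auto intro: less_imp_le)
  finally show ?thesis .
qed

lemma blade_sign_min:
  assumes "\<forall>a\<in>S. b < a"
  shows "blade_sign {b} S = 1"
  unfolding blade_sign_def using assms by (auto intro!: prod.neutral)

lemma blade_eq_gprod_list:
  "blade S = gprod_list (map (\<lambda>i. gvec (axis i 1)) (sorted_list_of_set S))"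
proof (induction S rule: finite_linorder_min_induct[OF finite])
  case 1
  then show ?case by (simp add: gprod_list_def)
next
  case (2 b S)
  then have "b \<notin> S" by blast
  then have "sym_diff {b} S = insert b S" by blast
  then have "blade (insert b S) = blade {b} \<odot> blade S"
    using 2(2) by (simp only: gprod_blade blade_sign_min scaleR_one)
  also have "\<dots> = gprod_list (map (\<lambda>i. gvec (axis i 1)) (sorted_list_of_set (insert b S)))"
    using 2 by (simp add: gprod_list_def sorted_list_of_set_insert_min gvec_axis
      del: sorted_list_of_set_insert_remove)
  finally show ?case .
qed

lemma unit_pseudoscalar_eq_blade: "unit_pseudoscalar = blade UNIV"
  by (simp add: unit_pseudoscalar_def blade_eq_gprod_list)

lemma linear_outermorphism: "linear (outermorphism L)"
  by (rule linearI) (simp_all add: outermorphism_def algebra_simps sum.distrib scaleR_sum_right)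

lemma outermorphism_blade:
  "outermorphism L (blade S) = outer_list (map (\<lambda>i. gvec (L (axis i 1))) (sorted_list_of_set S))"
  unfolding outermorphism_def by (rule sum_blade)

lemma outermorphism_one: "outermorphism L (blade {}) = blade {}"
  by (simp add: outermorphism_blade outer_list_def)

lemma outermorphism_gvec:
  assumes "linear L"
  shows "outermorphism L (gvec u) = gvec (L u)"
proof -
  have "linear (\<lambda>u. outermorphism L (gvec u))" "linear (\<lambda>u. gvec (L u))"
    using linear_compose[OF linear_gvec linear_outermorphism] linear_compose[OF assms linear_gvec]
    by (simp_all add: o_def)
  moreover have "outermorphism L (gvec b) = gvec (L b)" if "b \<in> Basis" for b
  proof -
    from that obtain i where b: "b = axis i 1" by (auto simp: Basis_vec_def)
    show ?thesis
      by (simp add: b gvec_axis outermorphism_blade outer_list_def outer_one)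
  qed
  ultimately have "(\<lambda>u. outermorphism L (gvec u)) = (\<lambda>u. gvec (L u))"
    by (rule linear_eq_stdbasis)
  then show ?thesis by metis
qed

theorem outermorphism_outer:
  assumes "linear L"
  shows "outermorphism L (A \<curlywedge> B) = outermorphism L A \<curlywedge> outermorphism L B"
proof -
  define f where "f i = gvec (L (axis i 1))" for i
  define G where "G S = outermorphism L (blade S)" for S
  have G_min: "G (insert b S) = f b \<curlywedge> G S" if "\<forall>a\<in>S. b < a" for b S
    using that by (simp add: G_def f_def outermorphism_blade outer_list_def sorted_list_of_set_insert_min
      del: sorted_list_of_set_insert_remove)
  have self: "f i \<curlywedge> (f i \<curlywedge> X) = 0" for i X
    using linear_0[OF linear_outer_left] by (simp add: f_def outer_gvec_self flip: outer_assoc)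
  have swap: "f i \<curlywedge> (f j \<curlywedge> X) = - (f j \<curlywedge> (f i \<curlywedge> X))" for i j X
    using outer_gvec_anticommute[of "L (axis i 1)" "L (axis j 1)"] linear_neg[OF linear_outer_left]
    by (simp add: f_def flip: outer_assoc)
  have step: "f i \<curlywedge> G T = outermorphism L (blade {i} \<curlywedge> blade T)" for i T
  proof (induction T rule: finite_linorder_min_induct[OF finite])
    case 1
    show ?case
      using G_min[of "{}" i] by (simp add: outer_blade blade_sign_def G_def)
  next
    case (2 b T)
    note IH = 2(3)
    show ?case
    proof (cases i b rule: linorder_cases)
      case less
      then have "\<forall>a\<in>insert b T. i < a" using 2(2) by auto
      then show ?thesis
        using G_min[of "insert b T" i] blade_sign_min[of "insert b T" i] by (auto simp: outer_blade G_def insert_commute)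
    next
      case equal
      then show ?thesis
        using G_min[of T b] 2(2) self linear_0[OF linear_outermorphism] by (simp add: outer_blade)
    next
      case greater
      have bT: "b \<notin> T" using 2(2) by blast
      have eq: "f i \<curlywedge> G (insert b T) = - (f b \<curlywedge> outermorphism L (blade {i} \<curlywedge> blade T))"
        using G_min[of T b] 2(2) swap IH by simp
      show ?thesis
      proof (cases "i \<in> T")
        case True
        then show ?thesis
          using eq by (simp add: outer_blade linear_0[OF linear_outermorphism] linear_0[OF linear_outer_right])
      next
        case False
        have "G (insert b (insert i T)) = f b \<curlywedge> G (insert i T)"
          using G_min[of "insert i T" b] greater 2(2) by auto
        moreover have "blade_sign {i} (insert b T) = - blade_sign {i} T"
          using bT greater by (simp add: blade_sign_def)
        moreover have "f i \<curlywedge> G (insert b T) = - (blade_sign {i} T *\<^sub>R (f b \<curlywedge> G (insert i T)))"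
          using eq False
          by (simp add: outer_blade G_def linear_scale[OF linear_outermorphism] linear_scale[OF linear_outer_right])
        moreover have "outermorphism L (blade {i} \<curlywedge> blade (insert b T))
            = blade_sign {i} (insert b T) *\<^sub>R G (insert b (insert i T))"
          using False greater
          by (simp add: outer_blade G_def linear_scale[OF linear_outermorphism] insert_commute)
        ultimately show ?thesis by simp
      qed
    qed
  qed
  have step': "f i \<curlywedge> outermorphism L X = outermorphism L (blade {i} \<curlywedge> X)" for i X
  proof (rule multivector_eqI[of "\<lambda>X. f i \<curlywedge> outermorphism L X"])
    show "linear (\<lambda>X. f i \<curlywedge> outermorphism L X)"
      by (rule linear_compose[OF linear_outermorphism linear_outer_right, unfolded o_def])
    show "linear (\<lambda>X. outermorphism L (blade {i} \<curlywedge> X))"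
      by (rule linear_compose[OF linear_outer_right linear_outermorphism, unfolded o_def])
    show "f i \<curlywedge> outermorphism L (blade S) = outermorphism L (blade {i} \<curlywedge> blade S)" for S
      using step by (simp only: G_def)
  qed
  have blades: "outermorphism L (blade S \<curlywedge> B) = G S \<curlywedge> outermorphism L B" for S
  proof (induction S rule: finite_linorder_min_induct[OF finite])
    case 1
    show ?case by (simp add: G_def outermorphism_one one_outer)
  next
    case (2 b S)
    then have "b \<notin> S" by blast
    then have "blade (insert b S) = blade {b} \<curlywedge> blade S"
      using 2(2) by (simp add: outer_blade blade_sign_min)
    then have "outermorphism L (blade (insert b S) \<curlywedge> B) = f b \<curlywedge> outermorphism L (blade S \<curlywedge> B)"
      by (simp only: step' outer_assoc)
    also have "\<dots> = G (insert b S) \<curlywedge> outermorphism L B"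
      using 2 by (simp only: G_min outer_assoc)
    finally show ?case .
  qed
  show ?thesis
  proof (rule multivector_eqI[of "\<lambda>A. outermorphism L (A \<curlywedge> B)"])
    show "linear (\<lambda>A. outermorphism L (A \<curlywedge> B))"
      by (rule linear_compose[OF linear_outer_left linear_outermorphism, unfolded o_def])
    show "linear (\<lambda>A. outermorphism L A \<curlywedge> outermorphism L B)"
      by (rule linear_compose[OF linear_outermorphism linear_outer_left, unfolded o_def])
    show "outermorphism L (blade S \<curlywedge> B) = outermorphism L (blade S) \<curlywedge> outermorphism L B" for S
      using blades by (simp only: G_def)
  qed
qed

section \<open>Singular cubes and chains\<close>

definition C2_on :: "('a::real_normed_vector \<Rightarrow> 'b::real_normed_vector) \<Rightarrow> 'a set \<Rightarrow> bool" where
  "C2_on f S \<longleftrightarrow>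
     (\<exists>(f' :: 'a \<Rightarrow> 'a \<Rightarrow>\<^sub>L 'b) (f'' :: 'a \<Rightarrow> 'a \<Rightarrow>\<^sub>L 'a \<Rightarrow>\<^sub>L 'b).
        (\<forall>x\<in>S. (f has_derivative blinfun_apply (f' x)) (at x)) \<and>
        (\<forall>x\<in>S. (f' has_derivative blinfun_apply (f'' x)) (at x)) \<and>
        continuous_on S f'')"

text \<open>\<open>\<phi>'(x, A)\<close>: the differential of \<open>\<phi>\<close> at \<open>x\<close>, extended to multivectors \<open>A\<close>.\<close>

definition differential ::
    "('n::{finite,linorder} point \<Rightarrow> 'm::{finite,linorder} point) \<Rightarrow> 'n point \<Rightarrow> 'n multivector \<Rightarrow> 'm multivector" where
  "differential \<phi> x = outermorphism (frechet_derivative \<phi> (at x))"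

definition jacobian :: "('n::{finite,linorder} point \<Rightarrow> 'm::{finite,linorder} point) \<Rightarrow> 'n point \<Rightarrow> real" where
  "jacobian \<phi> x = norm (differential \<phi> x unit_pseudoscalar)"

text \<open>The tangent \<open>V(X)\<close> at \<open>X = \<phi> x\<close>, determined by \<open>\<phi>'(x, v) = J(x) V(X)\<close>.\<close>

definition tangent ::
    "('n::{finite,linorder} point \<Rightarrow> 'm::{finite,linorder} point) \<Rightarrow> 'n point \<Rightarrow> 'm multivector" where
  "tangent \<phi> x = (1 / jacobian \<phi> x) *\<^sub>R differential \<phi> x unit_pseudoscalar"

text \<open>
  In \<open>real ^ 'n\<close> the points \<open>0\<close> and \<open>1\<close> have all coordinates \<open>0\<close> and all coordinates \<open>1\<close>, so
  \<open>cbox 0 1\<close> and \<open>box 0 1\<close> are the closed and open unit cubes.  Maps on the closed unit cube are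
  represented by extensional functions, so that they are equal iff they agree on it.
\<close>

definition C2_singular_cube ::
    "('n::{finite,linorder} point \<Rightarrow> 'm::{finite,linorder} point) \<Rightarrow> bool" where
  "C2_singular_cube \<phi> \<longleftrightarrow>
     \<phi> \<in> extensional (cbox 0 1) \<and> continuous_on (cbox 0 1) \<phi> \<and> C2_on \<phi> (box 0 1) \<and>
     (\<forall>x\<in>box 0 1. jacobian \<phi> x > 0)"

type_synonym ('n, 'm) chain = "('n point \<Rightarrow> 'm point) \<Rightarrow>\<^sub>0 int"

definition C2_chain :: "('n::{finite,linorder}, 'm::{finite,linorder}) chain \<Rightarrow> bool" where
  "C2_chain M \<longleftrightarrow> (\<forall>\<phi>\<in>Poly_Mapping.keys M. C2_singular_cube \<phi>)"

definition differentiable_on_chain ::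
    "('m::finite point \<Rightarrow> 'b::real_normed_vector) \<Rightarrow> ('n::finite, 'm) chain \<Rightarrow> bool" where
  "differentiable_on_chain F M \<longleftrightarrow>
     (\<forall>\<phi>\<in>Poly_Mapping.keys M. \<forall>x\<in>box 0 1. (F \<circ> \<phi>) differentiable (at x))"

text \<open>\<open>\<partial>\<^sub>i F (\<phi> x)\<close>, the partial derivative of \<open>F \<circ> \<phi>\<close> at \<open>x\<close>.\<close>

definition chain_partial ::
    "('n::finite point \<Rightarrow> 'm::finite point) \<Rightarrow> ('m point \<Rightarrow> 'b::real_normed_vector) \<Rightarrow> 'n point \<Rightarrow> 'n \<Rightarrow> 'b" where
  "chain_partial \<phi> F x i = vector_derivative (\<lambda>t. (F \<circ> \<phi>) (x + t *\<^sub>R axis i 1)) (at 0)"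

section \<open>Directed boundary integrals\<close>

definition closed_cube :: "('n::finite point) set \<Rightarrow> bool" where
  "closed_cube c \<longleftrightarrow> (\<exists>p s. 0 < s \<and> c = cbox p (p + s *\<^sub>R 1))"

text \<open>
  The \<open>(n - 1)\<close>-volume on the hyperplane \<open>{x. x $ i = t}\<close>: Lebesgue measure in the coordinates other
  than \<open>i\<close>.  For \<open>n = 1\<close> the product is empty and this is the unit mass at the single point.
\<close>

definition hyperplane_volume :: "'n::finite \<Rightarrow> real \<Rightarrow> ('n point) measure" where
  "hyperplane_volume i t =
     distr (Pi\<^sub>M (UNIV - {i}) (\<lambda>_. lborel)) borel (\<lambda>y. \<chi> j. if j = i then t else y j)"

text \<open>
  \<open>\<integral>\<^bsub>\<partial>c\<^esub> |da| G(x, \<nu>)\<close>, where \<open>\<nu>\<close> is the outward unit normal: the sum over the \<open>2 n\<close> faces of \<open>c\<close>,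
  which overlap in sets of \<open>(n - 1)\<close>-volume zero.
\<close>

definition boundary_integral ::
    "('n::finite point) set \<Rightarrow> ('n point \<Rightarrow> 'n point \<Rightarrow> 'b::{banach,second_countable_topology}) \<Rightarrow> 'b" where
  "boundary_integral c G = (\<Sum>i\<in>UNIV.
     (let t = interval_upperbound c $ i
      in LINT x:{x\<in>c. x $ i = t}|hyperplane_volume i t. G x (axis i 1)) +
     (let t = interval_lowerbound c $ i
      in LINT x:{x\<in>c. x $ i = t}|hyperplane_volume i t. G x (- axis i 1)))"

text \<open>The tangent \<open>v \<nu>\<close> to a hypersurface in \<open>real ^ 'n\<close> with unit normal \<open>\<nu>\<close>.\<close>

definition hypersurface_tangent :: "'n::{finite,linorder} point \<Rightarrow> 'n multivector" where
  "hypersurface_tangent \<nu> = unit_pseudoscalar \<odot> gvec \<nu>"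

text \<open>\<open>\<integral>\<^bsub>\<partial>C\<^esub> dA F\<close> for \<open>C = \<phi>(c)\<close>.\<close>

definition directed_boundary_integral ::
    "('n::{finite,linorder} point \<Rightarrow> 'm::{finite,linorder} point) \<Rightarrow> ('m point \<Rightarrow> 'm multivector) \<Rightarrow>
     ('n point) set \<Rightarrow> 'm multivector" where
  "directed_boundary_integral \<phi> F c =
     boundary_integral c (\<lambda>x \<nu>. differential \<phi> x (hypersurface_tangent \<nu>) \<odot> F (\<phi> x))"

text \<open>The \<open>n\<close>-volume \<open>|C|\<close> of the parametrized piece \<open>C = \<phi>(c)\<close>.\<close>

definition image_volume ::
    "('n::{finite,linorder} point \<Rightarrow> 'm::{finite,linorder} point) \<Rightarrow> ('n point) set \<Rightarrow> real" where
  "image_volume \<phi> c = (LINT x:c|lborel. jacobian \<phi> x)"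

section \<open>The tangential derivative\<close>

text \<open>The limit over the closed cubes \<open>c\<close> in the unit cube with \<open>x \<in> c\<close> and \<open>diam c \<rightarrow> 0\<close>.\<close>

definition shrinking_cubes :: "'n::finite point \<Rightarrow> ('n point) set filter" where
  "shrinking_cubes x =
     (INF r\<in>{0<..}. principal {c. closed_cube c \<and> c \<subseteq> cbox 0 1 \<and> x \<in> c \<and> diameter c < r})"

definition boundary_density ::
    "('n::{finite,linorder} point \<Rightarrow> 'm::{finite,linorder} point) \<Rightarrow> ('m point \<Rightarrow> 'm multivector) \<Rightarrow>
     ('n point) set \<Rightarrow> 'm multivector" where
  "boundary_density \<phi> F c = (1 / image_volume \<phi> c) *\<^sub>R directed_boundary_integral \<phi> F c"

definition tangential_derivative_exists ::
    "('n::{finite,linorder} point \<Rightarrow> 'm::{finite,linorder} point) \<Rightarrow> ('m point \<Rightarrow> 'm multivector) \<Rightarrow>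
     'n point \<Rightarrow> bool" where
  "tangential_derivative_exists \<phi> F x \<longleftrightarrow>
     (\<exists>L. (boundary_density \<phi> F \<longlongrightarrow> L) (shrinking_cubes x))"

text \<open>\<open>\<nabla>\<^sub>V F (X)\<close> at \<open>X = \<phi> x\<close>, computed with \<open>\<phi>\<close>.\<close>

definition tangential_derivative ::
    "('n::{finite,linorder} point \<Rightarrow> 'm::{finite,linorder} point) \<Rightarrow> ('m point \<Rightarrow> 'm multivector) \<Rightarrow>
     'n point \<Rightarrow> 'm multivector" where
  "tangential_derivative \<phi> F x =
     greverse (tangent \<phi> x) \<odot> Lim (shrinking_cubes x) (boundary_density \<phi> F)"

definition orientation_preserving_coordinate_change ::
    "('n::finite point) set \<Rightarrow> ('n point) set \<Rightarrow> ('n point \<Rightarrow> 'n point) \<Rightarrow> bool" where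
  "orientation_preserving_coordinate_change U W g \<longleftrightarrow>
     open U \<and> open W \<and> bij_betw g U W \<and> C2_on g U \<and> C2_on (the_inv_into U g) W \<and>
     (\<forall>y\<in>U. det (matrix (frechet_derivative g (at y))) > 0)"

text \<open>
  \<open>\<psi>\<close> near \<open>y\<^sub>0\<close> and \<open>\<phi>\<close> near \<open>x\<^sub>0\<close> parametrize the same piece of surface with the same orientation:
  \<open>\<phi>\<^sup>-\<^sup>1 \<circ> \<psi>\<close>, with \<open>\<phi>\<close> inverted near \<open>x\<^sub>0\<close>, is an orientation-preserving change of coordinates.
\<close>

definition same_oriented_parametrization ::
    "('n::finite point \<Rightarrow> 'm::finite point) \<Rightarrow> 'n point \<Rightarrow> ('n point \<Rightarrow> 'm point) \<Rightarrow> 'n point \<Rightarrow> bool" where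
  "same_oriented_parametrization \<phi> x\<^sub>0 \<psi> y\<^sub>0 \<longleftrightarrow>
     \<psi> y\<^sub>0 = \<phi> x\<^sub>0 \<and>
     (\<exists>U W. y\<^sub>0 \<in> U \<and> U \<subseteq> box 0 1 \<and> x\<^sub>0 \<in> W \<and> W \<subseteq> box 0 1 \<and> inj_on \<phi> W \<and> \<psi> ` U = \<phi> ` W \<and>
        orientation_preserving_coordinate_change U W (the_inv_into W \<phi> \<circ> \<psi>))"

end

theory Submission
  imports Defs
begin

text \<open>
  Let \<open>G\<^sub>i(x) = \<phi>'(x, a\<^sub>i) F(\<phi> x)\<close>.  The normal of a face of a cube \<open>c\<close> is \<open>\<plusminus>e\<^sub>i\<close> and its tangent is \<open>\<plusminus>a\<^sub>i\<close>, so
  the directed boundary integral over \<open>c\<close> is the sum over \<open>i\<close> of the integral of \<open>G\<^sub>i\<close> over the face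
  with normal \<open>+e\<^sub>i\<close> minus that over the opposite face.  If \<open>G\<^sub>i\<close> is continuous near \<open>x\<^sub>0\<close> and
  differentiable at \<open>x\<^sub>0\<close>, this difference is \<open>\<partial>\<^sub>iG\<^sub>i(x\<^sub>0) |c| + o(|c|)\<close> as \<open>c\<close> shrinks to \<open>x\<^sub>0\<close>
  (\<open>face_flux_tendsto\<close>): the values at opposite points of the two faces differ by \<open>s \<partial>\<^sub>iG\<^sub>i(x\<^sub>0) + o(s)\<close>,
  where \<open>s\<close> is the side of \<open>c\<close>.

  By the product rule \<open>\<Sum>\<^sub>i \<partial>\<^sub>iG\<^sub>i = (\<Sum>\<^sub>i \<partial>\<^sub>i \<phi>'(x, a\<^sub>i)) F + \<Sum>\<^sub>i \<phi>'(x, a\<^sub>i) \<partial>\<^sub>iF\<close>, and the first sum vanishes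
  (\<open>hypersurface_tangent_divergence_free\<close>): up to sign \<open>\<phi>'(x, a\<^sub>i)\<close> is the outer product of the \<open>\<partial>\<^sub>j\<phi>\<close>
  with \<open>j \<noteq> i\<close>, so its derivative along \<open>e\<^sub>i\<close> is a sum of terms containing one factor \<open>\<partial>\<^sub>i\<partial>\<^sub>k\<phi>\<close>; the
  term of \<open>(i, k)\<close> and the term of \<open>(k, i)\<close> agree up to sign because mixed partial derivatives commute,
  and their signs are opposite.  Dividing by \<open>|C|\<close> instead of \<open>|c|\<close> costs the factor \<open>1 / J(x\<^sub>0)\<close>, since
  \<open>|C| / |c|\<close> is an average of \<open>J\<close>.  This gives the limit and the formula for \<open>\<nabla>\<^sub>V F\<close>.

  Invariance is read off from that formula.  If \<open>\<psi> = \<phi> \<circ> g\<close> near \<open>y\<^sub>0\<close> and \<open>L\<close> is the differential of \<open>g\<close>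
  at \<open>y\<^sub>0\<close>, then \<open>L(v) = det L v\<close> (\<open>outermorphism_pseudoscalar\<close>), so that \<open>J\<close> is multiplied by \<open>det L\<close>
  and \<open>V\<close> is unchanged when \<open>det L > 0\<close>.  The sum \<open>\<Sum>\<^sub>i \<phi>'(x, a\<^sub>i) \<partial>\<^sub>iF\<close> is multiplied by \<open>det L\<close> as well,
  by the chain rule and the cofactor expansion in the form \<open>\<Sum>\<^sub>i L\<^sub>j\<^sub>i L(a\<^sub>i) = det L a\<^sub>j\<close>
  (\<open>outermorphism_hypersurface_tangent\<close>).
\<close>

section \<open>Outermorphisms of linear maps\<close>

lemma bounded_bilinear_outer: "bounded_bilinear (\<curlywedge>)"
  by (simp add: bilinear_def linear_outer_left linear_outer_right flip: bilinear_conv_bounded_bilinear)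

lemma bounded_bilinear_gprod: "bounded_bilinear (\<odot>)"
  by (simp add: bilinear_def linear_gprod_left linear_gprod_right flip: bilinear_conv_bounded_bilinear)

interpretation outer: bounded_bilinear "(\<curlywedge>) :: 'a::{finite,linorder} multivector \<Rightarrow> _"
  by (rule bounded_bilinear_outer)

interpretation gprod: bounded_bilinear "(\<odot>) :: 'a::{finite,linorder} multivector \<Rightarrow> _"
  by (rule bounded_bilinear_gprod)

lemmas gvec_add = linear_add[OF linear_gvec]
  and gvec_scaleR = linear_scale[OF linear_gvec]
  and gvec_minus = linear_neg[OF linear_gvec]
  and gvec_zero = linear_0[OF linear_gvec]

lemmas outermorphism_minus = linear_neg[OF linear_outermorphism]
  and outermorphism_scaleR = linear_scale[OF linear_outermorphism]

lemma blade_sign_Un_right: "T \<inter> U = {} \<Longrightarrow> blade_sign S (T \<union> U) = blade_sign S T * blade_sign S U"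
  by (simp add: blade_sign_def prod.union_disjoint prod.distrib)

lemma blade_sign_square: "blade_sign S T * blade_sign S T = 1"
  unfolding blade_sign_def prod.distrib[symmetric] by (intro prod.neutral ballI) auto

lemma blade_sign_remove: "blade_sign {i} (S - {i}) = blade_sign {i} S"
proof (cases "i \<in> S")
  case True
  then have "blade_sign {i} S = blade_sign {i} ((S - {i}) \<union> {i})"
    by (simp add: insert_absorb)
  also have "\<dots> = blade_sign {i} (S - {i})"
    by (subst blade_sign_Un_right) (auto simp: blade_sign_def)
  finally show ?thesis by simp
qed simp

lemma blade_sign_singleton_mult:
  "blade_sign {i} {j} * blade_sign {j} {i} = (if i = j then 1 else - 1)"
  by (auto simp: blade_sign_def)

text \<open>
  Independence of \<open>i\<close> is what matters: moving \<open>e\<^sub>i\<close> from the right end of \<open>v\<close> to the left end costs the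
  same sign for every \<open>i\<close>, so the two ways of splitting \<open>e\<^sub>i\<close> off \<open>v\<close> can be exchanged throughout.
\<close>

lemma blade_sign_UNIV_mult:
  fixes i :: "'n::{finite,linorder}"
  shows "blade_sign UNIV {i} * blade_sign {i} UNIV = (- 1) ^ (CARD('n) - 1)"
proof -
  have "blade_sign UNIV {i} * blade_sign {i} UNIV
      = (\<Prod>j\<in>UNIV. blade_sign {j} {i} * blade_sign {i} {j})"
    by (simp add: blade_sign_def prod.distrib)
  also have "\<dots> = (\<Prod>j\<in>insert i (UNIV - {i}). if j = i then 1 else - 1)"
    by (simp add: blade_sign_singleton_mult insert_absorb cong: prod.cong)
  also have "\<dots> = (\<Prod>j\<in>UNIV - {i}. - 1)"
    by (subst prod.insert) (auto intro!: prod.cong)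
  finally show ?thesis by (simp add: card_Diff_singleton)
qed

lemma multivector_eq_sum: "A = (\<Sum>S\<in>UNIV. (A $ S) *\<^sub>R blade S)"
  by (simp add: vec_eq_iff blade_nth if_distrib[of "(*) _"] cong: if_cong)

lemma hypersurface_tangent_axis:
  "hypersurface_tangent (axis i 1) = blade_sign UNIV {i} *\<^sub>R blade (UNIV - {i})"
  by (simp add: hypersurface_tangent_def unit_pseudoscalar_eq_blade gvec_axis gprod_blade)

lemma hypersurface_tangent_minus: "hypersurface_tangent (- u) = - hypersurface_tangent u"
  by (simp add: hypersurface_tangent_def gvec_minus gprod.minus_right)

lemma outermorphism_cong:
  assumes "\<And>i. i \<in> S \<Longrightarrow> K (axis i 1) = L (axis i 1)"
  shows "outermorphism K (blade S) = outermorphism L (blade S)"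
  using assms by (auto simp: outermorphism_blade intro!: arg_cong[where f = outer_list])

lemma outermorphism_insert_min:
  assumes "\<forall>a\<in>S. b < a"
  shows "outermorphism L (blade (insert b S)) = gvec (L (axis b 1)) \<curlywedge> outermorphism L (blade S)"
  using assms
  by (simp add: outermorphism_blade outer_list_def sorted_list_of_set_insert_min
      del: sorted_list_of_set_insert_remove)

lemma outermorphism_id: "outermorphism (\<lambda>x. x) A = A"
proof (rule multivector_eqI[of "outermorphism (\<lambda>x. x)"])
  show "outermorphism (\<lambda>x. x) (blade S) = blade S" for S :: "'a set"
  proof (induction S rule: finite_linorder_min_induct[OF finite])
    case 1
    then show ?case by (simp add: outermorphism_one)
  next
    case (2 b S)
    then show ?case
      using blade_sign_min[OF 2(2)] by (auto simp: outermorphism_insert_min gvec_axis outer_blade)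
  qed
qed (simp_all add: linear_outermorphism linear_id[unfolded id_def])

lemma outermorphism_compose:
  assumes "linear K" "linear L"
  shows "outermorphism (\<lambda>x. K (L x)) A = outermorphism K (outermorphism L A)"
proof (rule multivector_eqI[of "outermorphism (\<lambda>x. K (L x))"])
  show "outermorphism (\<lambda>x. K (L x)) (blade S) = outermorphism K (outermorphism L (blade S))" for S
  proof (induction S rule: finite_linorder_min_induct[OF finite])
    case 1
    then show ?case by (simp add: outermorphism_one)
  next
    case (2 b S)
    then show ?case
      by (simp add: outermorphism_insert_min outermorphism_outer assms outermorphism_gvec)
  qed
  show "linear (\<lambda>x. outermorphism K (outermorphism L x))"
    using linear_compose[OF linear_outermorphism linear_outermorphism] by (simp add: o_def)
qed (rule linear_outermorphism)

subsection \<open>The action on the pseudoscalar is the determinant\<close>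

lemma gvec_outer_hyperplane_blade:
  "gvec u \<curlywedge> blade (UNIV - {k}) = (u $ k * blade_sign {k} UNIV) *\<^sub>R blade UNIV"
proof -
  have "gvec u \<curlywedge> blade (UNIV - {k}) = (\<Sum>i\<in>UNIV. (u $ i) *\<^sub>R (blade {i} \<curlywedge> blade (UNIV - {k})))"
    by (simp add: gvec_def outer.sum_left outer.scaleR_left)
  also have "\<dots> = (\<Sum>i\<in>UNIV. if i = k then (u $ k) *\<^sub>R (blade_sign {k} UNIV *\<^sub>R blade UNIV) else 0)"
    by (intro sum.cong refl) (auto simp: outer_blade blade_sign_remove)
  finally show ?thesis by simp
qed

text \<open>
  Any single vector can be split off the pseudoscalar.  Read with \<open>u = e\<^sub>k\<close> this shows that
  \<open>L(v)\<close> is linear in the column \<open>L e\<^sub>k\<close>, as the other factor depends on the other columns only; read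
  with \<open>L u = 0\<close> it shows that \<open>L(v) = 0\<close> for singular \<open>L\<close>.
\<close>

lemma outermorphism_gvec_outer:
  assumes "linear L"
  shows "gvec (L u) \<curlywedge> outermorphism L (blade (UNIV - {k}))
    = (u $ k * blade_sign {k} UNIV) *\<^sub>R outermorphism L (blade UNIV)"
  using arg_cong[OF gvec_outer_hyperplane_blade[of u k], of "outermorphism L"]
  by (simp add: outermorphism_outer outermorphism_gvec assms outermorphism_scaleR)

lemma outermorphism_pseudoscalar_singular:
  assumes "linear L" "L u = 0" "u \<noteq> 0"
  shows "outermorphism L (blade UNIV) = 0"
proof -
  obtain k where k: "u $ k \<noteq> 0"
    using assms(3) by (auto simp: vec_eq_iff)
  have "blade_sign {k} (UNIV :: 'a set) \<noteq> 0"
    using blade_sign_square[of "{k}" UNIV] by auto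
  then show ?thesis
    using k outermorphism_gvec_outer[OF assms(1), of u k] assms(2)
    by (simp add: gvec_zero outer.zero_left)
qed

lemma outermorphism_pseudoscalar_add:
  assumes "linear K" "linear L" "linear N"
    and "\<And>i. i \<noteq> k \<Longrightarrow> K (axis i 1) = N (axis i 1)" "\<And>i. i \<noteq> k \<Longrightarrow> L (axis i 1) = N (axis i 1)"
    and "N (axis k 1) = K (axis k 1) + L (axis k 1)"
  shows "outermorphism N (blade UNIV) = outermorphism K (blade UNIV) + outermorphism L (blade UNIV)"
proof -
  let ?s = "blade_sign {k} (UNIV :: 'a set)"
  have eq: "outermorphism K (blade (UNIV - {k})) = outermorphism N (blade (UNIV - {k}))"
    "outermorphism L (blade (UNIV - {k})) = outermorphism N (blade (UNIV - {k}))"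
    using assms(4,5) by (auto intro!: outermorphism_cong)
  have "?s *\<^sub>R outermorphism N (blade UNIV)
      = ?s *\<^sub>R outermorphism K (blade UNIV) + ?s *\<^sub>R outermorphism L (blade UNIV)"
    using outermorphism_gvec_outer[OF assms(1), of "axis k 1" k]
      outermorphism_gvec_outer[OF assms(2), of "axis k 1" k]
      outermorphism_gvec_outer[OF assms(3), of "axis k 1" k]
    by (simp add: eq assms(6) gvec_add outer.add_left)
  then have "?s *\<^sub>R outermorphism N (blade UNIV)
      = ?s *\<^sub>R (outermorphism K (blade UNIV) + outermorphism L (blade UNIV))"
    by (simp add: scaleR_add_right)
  moreover have "?s \<noteq> 0"
    using blade_sign_square[of "{k}" UNIV] by auto
  ultimately show ?thesis by (simp only: scaleR_cancel_left) simp
qed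

text \<open>Transpositions and transvections are of this form, as they alter at most two columns of the
  identity matrix: here \<open>x\<close> and \<open>y\<close> become the images of \<open>e\<^sub>m\<close> and \<open>e\<^sub>n\<close>.\<close>

definition two_columns :: "'a::finite \<Rightarrow> 'a \<Rightarrow> 'a point \<Rightarrow> 'a point \<Rightarrow> 'a point \<Rightarrow> 'a point" where
  "two_columns m n x y z = z + (z $ m) *\<^sub>R (x - axis m 1) + (z $ n) *\<^sub>R (y - axis n 1)"

lemma linear_two_columns: "linear (two_columns m n x y)"
  by (rule linearI) (simp_all add: two_columns_def algebra_simps)

lemma two_columns_axis:
  assumes "m \<noteq> n"
  shows "two_columns m n x y (axis m 1) = x" "two_columns m n x y (axis n 1) = y"
    "i \<noteq> m \<Longrightarrow> i \<noteq> n \<Longrightarrow> two_columns m n x y (axis i 1) = axis i 1"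
  using assms by (simp_all add: two_columns_def axis_def)

text \<open>
  \<open>L(v)\<close> is additive in each column and vanishes when two columns coincide, because \<open>e\<^sub>m - e\<^sub>n\<close> is then in
  the kernel; exchanging two columns therefore changes the sign.
\<close>

lemma two_columns_pseudoscalar_alternating:
  fixes m n :: "'a::{finite,linorder}"
  assumes "m \<noteq> n"
  defines "\<Phi> \<equiv> \<lambda>x y. outermorphism (two_columns m n x y) (blade UNIV)"
  shows "\<Phi> (x + x') y = \<Phi> x y + \<Phi> x' y" "\<Phi> x (y + y') = \<Phi> x y + \<Phi> x y'" "\<Phi> x x = 0"
    "\<Phi> (axis m 1) (axis n 1) = blade UNIV" "\<Phi> (axis n 1) (axis m 1) = - blade UNIV"
proof -
  note ax = two_columns_axis[OF assms(1)]
  show 1: "\<Phi> (x + x') y = \<Phi> x y + \<Phi> x' y" for x x' y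
    unfolding \<Phi>_def using assms(1)
    by (intro outermorphism_pseudoscalar_add[where k = m]; (simp add: linear_two_columns ax)?)
      (metis ax)+
  show 2: "\<Phi> x (y + y') = \<Phi> x y + \<Phi> x y'" for x y y'
    unfolding \<Phi>_def using assms(1)
    by (intro outermorphism_pseudoscalar_add[where k = n]; (simp add: linear_two_columns ax)?)
      (metis ax)+
  show 3: "\<Phi> x x = 0" for x
  proof -
    have "axis m 1 - axis n (1::real) \<noteq> 0"
      using assms(1) by (simp add: axis_eq_axis)
    then show ?thesis
      unfolding \<Phi>_def
      by (intro outermorphism_pseudoscalar_singular[where u = "axis m 1 - axis n 1"])
        (simp_all add: linear_two_columns linear_diff[OF linear_two_columns] ax)
  qed
  have "two_columns m n (axis m 1) (axis n 1) = (\<lambda>x. x)"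
    by (simp add: two_columns_def fun_eq_iff)
  then show 4: "\<Phi> (axis m 1) (axis n 1) = blade UNIV"
    by (simp add: \<Phi>_def outermorphism_id)
  have "\<Phi> (axis n 1) (axis m 1) + \<Phi> (axis m 1) (axis n 1) = \<Phi> (axis m 1 + axis n 1) (axis m 1 + axis n 1)"
    by (simp only: 1 2) (simp add: 3)
  then show "\<Phi> (axis n 1) (axis m 1) = - blade UNIV"
    unfolding 3 4 by (simp only: eq_neg_iff_add_eq_0)
qed

lemma outermorphism_diagonal:
  "outermorphism (\<lambda>x. \<chi> i. c i * x $ i) (blade S) = (\<Prod>i\<in>S. c i) *\<^sub>R blade S"
proof (induction S rule: finite_linorder_min_induct[OF finite])
  case 1
  then show ?case by (simp add: outermorphism_one)
next
  case (2 b S)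
  have "(\<chi> i. c i * axis b 1 $ i) = c b *\<^sub>R axis b (1::real)"
    by (simp add: vec_eq_iff axis_def)
  moreover have "blade {b} \<curlywedge> blade S = blade (insert b S)" "b \<notin> S"
    using 2(2) blade_sign_min[OF 2(2)] by (auto simp: outer_blade)
  ultimately show ?case
    using 2 by (simp add: outermorphism_insert_min gvec_scaleR gvec_axis outer.scaleR_left outer.scaleR_right)
qed

text \<open>
  Both sides are multiplicative in \<open>L\<close> and vanish for singular \<open>L\<close>, so it suffices to compare them on
  diagonal maps, transpositions and transvections.
\<close>

theorem outermorphism_pseudoscalar:
  fixes L :: "'a::{finite,linorder} point \<Rightarrow> 'a point"
  assumes "linear L"
  shows "outermorphism L (blade UNIV) = det (matrix L) *\<^sub>R blade UNIV"
proof -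
  define P where
    "P L \<longleftrightarrow> outermorphism L (blade UNIV) = det (matrix L) *\<^sub>R blade UNIV" for L :: "'a point \<Rightarrow> 'a point"
  have comp: "P (f \<circ> g)" if "linear f" "linear g" "P f" "P g" for f g
    using that outermorphism_compose[of f g "blade UNIV"] matrix_compose[of g f]
    by (simp add: P_def o_def outermorphism_scaleR det_mul mult.commute)
  have zero: "P f" if f: "linear f" "\<And>x. f x $ i = 0" for f i
  proof -
    have "row i (matrix f) = 0"
      using f by (simp add: row_def matrix_def vec_eq_iff)
    then have det: "det (matrix f) = 0"
      by (rule det_zero_row)
    then obtain u where "u \<noteq> 0" "f u = 0"
      using det_nz_iff_inj[OF f(1)] linear_injective_0[OF f(1)] by blast
    then show ?thesis
      using outermorphism_pseudoscalar_singular[OF f(1)] det by (simp add: P_def)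
  qed
  have diagonal: "P (\<lambda>x. \<chi> i. c i * x $ i)" for c
    by (simp add: P_def outermorphism_diagonal axis_def matrix_def det_diagonal)
  have swap: "P (\<lambda>x. \<chi> i. x $ Transposition.transpose m n i)" if "m \<noteq> n" for m n
  proof -
    let ?h = "\<lambda>v::'a point. \<chi> i. v $ Transposition.transpose m n i"
    have "?h = two_columns m n (axis n 1) (axis m 1)"
      using that by (auto simp: fun_eq_iff vec_eq_iff two_columns_def axis_def Transposition.transpose_def)
    then have *: "outermorphism ?h (blade UNIV) = - blade UNIV"
      using two_columns_pseudoscalar_alternating(5)[OF that] by simp
    have "(\<chi> i j. if Transposition.transpose m n i = j then 1 else 0)
        = (\<chi> i j. if j = Transposition.transpose m n i then 1 else (0::real))"
      by (auto intro!: Cart_lambda_cong)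
    then have "matrix ?h = transpose(\<chi> i j. mat 1 $ i $ Transposition.transpose m n j)"
      by (auto simp: matrix_eq transpose_def axis_def mat_def matrix_def)
    then have "det (matrix ?h) = - 1"
      using that by (simp add: det_permute_columns permutes_swap_id sign_swap_id)
    with * show ?thesis by (simp add: P_def)
  qed
  have shear: "P (\<lambda>x. \<chi> i. if i = m then x $ m + x $ n else x $ i)" if "m \<noteq> n" for m n
  proof -
    let ?h = "\<lambda>v::'a point. \<chi> i. if i = m then v $ m + v $ n else v $ i"
    have "?h = two_columns m n (axis m 1) (axis n 1 + axis m 1)"
      using that by (auto simp: fun_eq_iff vec_eq_iff two_columns_def axis_def)
    then have *: "outermorphism ?h (blade UNIV) = blade UNIV"
      using two_columns_pseudoscalar_alternating[OF that] by simp
    have "matrix ?h = (\<chi> i. if i = m then row m (mat 1) + 1 *s row n (mat 1) else row i (mat 1))"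
      using that by (auto simp: matrix_def vec_eq_iff row_def mat_def axis_def)
    then have "det (matrix ?h) = 1"
      using det_row_operation[OF that, of "mat 1" 1] by simp
    with * show ?thesis by (simp add: P_def)
  qed
  have "P L"
    using comp zero diagonal swap shear by (rule induct_linear_elementary[OF assms])
  then show ?thesis by (simp add: P_def)
qed

subsection \<open>The action on hypersurface tangents\<close>

definition graded :: "nat \<Rightarrow> 'a::finite multivector \<Rightarrow> bool" where
  "graded k A \<longleftrightarrow> (\<forall>S. A $ S \<noteq> 0 \<longrightarrow> card S = k)"

lemma graded_blade: "graded (card S) (blade S)"
  by (simp add: graded_def blade_nth)

lemma graded_scaleR: "graded k A \<Longrightarrow> graded k (c *\<^sub>R A)"
  by (simp add: graded_def)

lemma graded_diff: "graded k A \<Longrightarrow> graded k B \<Longrightarrow> graded k (A - B)"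
  by (force simp: graded_def)

lemma graded_sum: "(\<And>i. i \<in> I \<Longrightarrow> graded k (A i)) \<Longrightarrow> graded k (\<Sum>i\<in>I. A i)"
  by (force simp: graded_def dest: sum.not_neutral_contains_not_neutral)

lemma graded_outermorphism: "graded (card S) (outermorphism L (blade S))"
proof (induction S rule: finite_linorder_min_induct[OF finite])
  case 1
  then show ?case using graded_blade[of "{}"] by (simp add: outermorphism_one)
next
  case (2 b S)
  then have "b \<notin> S" by blast
  define u where "u = L (axis b 1)"
  define X where "X = outermorphism L (blade S)"
  have "graded (Suc (card S)) (blade {i} \<curlywedge> blade T)" if "card T = card S" for i T
    using that graded_blade[of "insert i T"] graded_scaleR
    by (auto simp: outer_blade graded_def[of _ 0])
  then have "graded (Suc (card S)) ((u $ i * X $ T) *\<^sub>R (blade {i} \<curlywedge> blade T))" for i T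
    using 2(3) by (cases "X $ T = 0") (auto simp: graded_def X_def)
  then have "graded (Suc (card S)) (\<Sum>i\<in>UNIV. \<Sum>T\<in>UNIV. (u $ i * X $ T) *\<^sub>R (blade {i} \<curlywedge> blade T))"
    by (intro graded_sum)
  also have "(\<Sum>i\<in>UNIV. \<Sum>T\<in>UNIV. (u $ i * X $ T) *\<^sub>R (blade {i} \<curlywedge> blade T)) = gvec u \<curlywedge> X"
    by (subst (2) multivector_eq_sum[of X], subst sum.swap)
      (simp add: gvec_def outer.sum_left outer.sum_right outer.scaleR_left outer.scaleR_right
        scaleR_sum_right mult.commute)
  finally show ?case
    using 2 \<open>b \<notin> S\<close> by (simp add: outermorphism_insert_min u_def X_def)
qed

text \<open>
  The pairing \<open>(u, X) \<mapsto> u \<and> X\<close> between vectors and \<open>(n - 1)\<close>-vectors is perfect: up to sign, the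
  coordinate of \<open>e\<^sub>k \<and> X\<close> along \<open>v\<close> is the coordinate of \<open>X\<close> along the blade that omits \<open>e\<^sub>k\<close>.
\<close>

lemma graded_hyperplane_eq_0:
  fixes X :: "'a::{finite,linorder} multivector"
  assumes "graded (CARD('a) - 1) X" "\<And>u. gvec u \<curlywedge> X = 0"
  shows "X = 0"
proof -
  have "X $ S = 0" for S
  proof (rule ccontr)
    assume S: "X $ S \<noteq> 0"
    then have "card (UNIV - S) = 1"
      using assms(1) finite_UNIV_card_ge_0[where 'a = 'a]
      by (auto simp: graded_def card_Diff_subset)
    then obtain k where k: "UNIV - S = {k}"
      by (auto simp: card_1_singleton_iff)
    have "(blade {k} \<curlywedge> X) $ UNIV = blade_sign {k} UNIV * X $ (UNIV - {k})"
    proof (rule multivector_eqI[of "\<lambda>X. (blade {k} \<curlywedge> X) $ UNIV"])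
      show "linear (\<lambda>X. (blade {k} \<curlywedge> X) $ UNIV)"
        by (rule linearI) (simp_all add: outer.add_right outer.scaleR_right)
      show "linear (\<lambda>X. blade_sign {k} UNIV * X $ (UNIV - {k}))"
        by (rule linearI) (simp_all add: algebra_simps)
      show "(blade {k} \<curlywedge> blade T) $ UNIV = blade_sign {k} UNIV * blade T $ (UNIV - {k})" for T
        using blade_sign_remove[of k UNIV] by (auto simp: outer_blade blade_nth)
    qed
    moreover have "blade {k} \<curlywedge> X = 0"
      using assms(2)[of "axis k 1"] by (simp add: gvec_axis)
    moreover have "S = UNIV - {k}" using k by blast
    ultimately show False
      using S blade_sign_square[of "{k}" UNIV] by auto
  qed
  then show ?thesis by (simp add: vec_eq_iff)
qed

text \<open>
  The cofactor expansion of \<open>det L\<close>.  Both sides are \<open>(n - 1)\<close>-vectors, so they may be compared by their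
  outer products with vectors, and since \<open>L\<close> is onto these vectors may be taken of the form \<open>L u\<close>.  Then
  the left side is governed by \<open>L(u) \<and> L(a\<^sub>i) = L(u \<and> a\<^sub>i) = \<plusminus> u\<^sub>i det L v\<close>, and the right side by
  \<open>L(u) \<and> a\<^sub>j = \<plusminus> L(u)\<^sub>j v\<close>, with the same sign in both.
\<close>

theorem outermorphism_hypersurface_tangent:
  fixes L :: "'a::{finite,linorder} point \<Rightarrow> 'a point"
  assumes "linear L" "det (matrix L) \<noteq> 0"
  shows "(\<Sum>i\<in>UNIV. (L (axis i 1) $ j) *\<^sub>R outermorphism L (hypersurface_tangent (axis i 1)))
    = det (matrix L) *\<^sub>R hypersurface_tangent (axis j 1)"
proof -
  define X where "X = (\<Sum>i\<in>UNIV. (L (axis i 1) $ j) *\<^sub>R outermorphism L (hypersurface_tangent (axis i 1)))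
    - det (matrix L) *\<^sub>R hypersurface_tangent (axis j 1)"
  \<comment> \<open>The sign common to both sides; it does not depend on \<open>i\<close> or \<open>j\<close>.\<close>
  define \<kappa> :: real where "\<kappa> = (- 1) ^ (CARD('a) - 1)"
  have "graded (CARD('a) - 1) X"
    using graded_outermorphism[of "UNIV - {_}" L] graded_blade[of "UNIV - {_} :: 'a set"]
    unfolding X_def hypersurface_tangent_axis outermorphism_scaleR
    by (intro graded_diff graded_sum graded_scaleR) (simp_all add: card_Diff_singleton)
  moreover have "gvec w \<curlywedge> X = 0" for w
  proof -
    have "surj L"
      using assms det_nz_iff_inj linear_injective_imp_surjective by blast
    then obtain u where w: "w = L u" by blast
    have sgn: "blade_sign {i} UNIV * blade_sign UNIV {i} = \<kappa>" for i :: 'a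
      using blade_sign_UNIV_mult[of i] by (simp add: \<kappa>_def mult.commute)
    have 1: "gvec (L u) \<curlywedge> outermorphism L (hypersurface_tangent (axis i 1))
        = (u $ i * \<kappa> * det (matrix L)) *\<^sub>R blade UNIV" for i
      by (simp add: hypersurface_tangent_axis outermorphism_scaleR outer.scaleR_right
          outermorphism_gvec_outer assms outermorphism_pseudoscalar flip: sgn[of i])
    have 2: "gvec (L u) \<curlywedge> hypersurface_tangent (axis j 1) = (L u $ j * \<kappa>) *\<^sub>R blade UNIV"
      by (simp add: hypersurface_tangent_axis outer.scaleR_right gvec_outer_hyperplane_blade
          flip: sgn[of j])
    have "L u = (\<Sum>i\<in>UNIV. (u $ i) *\<^sub>R L (axis i 1))"
      using linear_sum[OF assms(1), of "\<lambda>i. (u $ i) *\<^sub>R axis i 1" UNIV] basis_expansion[of u]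
      by (simp add: linear_scale[OF assms(1)] scalar_mult_eq_scaleR)
    then have "L u $ j = (\<Sum>i\<in>UNIV. L (axis i 1) $ j * u $ i)"
      by (simp add: mult.commute)
    then show ?thesis
      unfolding X_def w
      by (simp add: outer.diff_right outer.sum_right outer.scaleR_right 1 2 sum_distrib_right
          sum_distrib_left mult_ac flip: scaleR_sum_left)
  qed
  ultimately have "X = 0" by (rule graded_hyperplane_eq_0)
  then show ?thesis by (simp add: X_def)
qed

section \<open>The field of tangents to the coordinate hyperplanes is divergence free\<close>

text \<open>
  The mean value inequality is applied to
  \<open>t \<mapsto> f(x + s h + t k) - f(x + t k) - t s f''(h)(k)\<close> on \<open>[0, s]\<close>, whose derivative is \<open>o(s)\<close>
  because \<open>f'\<close> is differentiable at \<open>x\<close>.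
\<close>

lemma second_difference_bound:
  fixes f :: "'a::real_normed_vector \<Rightarrow> 'b::real_normed_vector"
    and f' :: "'a \<Rightarrow> 'a \<Rightarrow>\<^sub>L 'b" and f'' :: "'a \<Rightarrow>\<^sub>L 'a \<Rightarrow>\<^sub>L 'b"
  assumes "open S" "x \<in> S"
    and f: "\<And>y. y \<in> S \<Longrightarrow> (f has_derivative f' y) (at y)"
    and f': "(f' has_derivative f'') (at x)"
    and "e > 0"
  shows "\<exists>d>0. \<forall>s. 0 < s \<and> s < d \<longrightarrow>
    norm (f (x + s *\<^sub>R h + s *\<^sub>R k) - f (x + s *\<^sub>R h) - f (x + s *\<^sub>R k) + f x - (s * s) *\<^sub>R f'' h k) \<le> e * (s * s)"
proof -
  define D where "D = norm h + norm k"
  \<comment> \<open>The bound below is \<open>2 \<eta> D\<^sup>2 s\<^sup>2\<close>; the summand \<open>1\<close> covers \<open>D = 0\<close>.\<close>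
  define \<eta> where "\<eta> = e / (2 * (D * D) + 1)"
  have "D \<ge> 0" by (simp add: D_def)
  then have "\<eta> > 0" using \<open>e > 0\<close> by (simp add: \<eta>_def add_nonneg_pos)
  then obtain d1 where "d1 > 0" and d1: "\<And>y. norm (y - x) < d1 \<Longrightarrow>
      norm (f' y - f' x - f'' (y - x)) \<le> \<eta> * norm (y - x)"
    using f' by (auto simp: has_derivative_at_alt)
  obtain d2 where "d2 > 0" and d2: "ball x d2 \<subseteq> S"
    using assms(1,2) by (auto simp: open_contains_ball)
  define d where "d = min d1 d2 / (D + 1)"
  have "d > 0" using \<open>d1 > 0\<close> \<open>d2 > 0\<close> \<open>D \<ge> 0\<close> by (simp add: d_def)
  have dv: "dist x (x + v) = norm v" for v
    by (simp add: dist_norm)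
  have "norm (f (x + s *\<^sub>R h + s *\<^sub>R k) - f (x + s *\<^sub>R h) - f (x + s *\<^sub>R k) + f x - (s * s) *\<^sub>R f'' h k)
      \<le> e * (s * s)" if "0 < s" "s < d" for s
  proof -
    have "s * (D + 1) < min d1 d2"
      using that(2) \<open>D \<ge> 0\<close> by (simp add: d_def pos_less_divide_eq add_nonneg_pos)
    then have small: "s * D < d1" "s * D < d2"
      using that(1) by (auto simp: algebra_simps)
    have dist: "norm (a *\<^sub>R h + t *\<^sub>R k) \<le> s * D" if "a \<in> {0..s}" "t \<in> {0..s}" for a t
    proof -
      have "norm (a *\<^sub>R h + t *\<^sub>R k) \<le> a * norm h + t * norm k"
        using that norm_triangle_ineq[of "a *\<^sub>R h" "t *\<^sub>R k"] by simp
      also have "\<dots> \<le> s * norm h + s * norm k"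
        using that by (intro add_mono mult_right_mono) auto
      finally show ?thesis by (simp add: D_def algebra_simps)
    qed
    define q where "q t = f (x + (s *\<^sub>R h + t *\<^sub>R k)) - f (x + (0 *\<^sub>R h + t *\<^sub>R k)) - t *\<^sub>R (s *\<^sub>R f'' h k)" for t
    define q' where "q' t = f' (x + (s *\<^sub>R h + t *\<^sub>R k)) k - f' (x + (0 *\<^sub>R h + t *\<^sub>R k)) k - s *\<^sub>R f'' h k" for t
    have der: "((\<lambda>t. f (x + (a *\<^sub>R h + t *\<^sub>R k))) has_derivative (\<lambda>r. r *\<^sub>R f' (x + (a *\<^sub>R h + t *\<^sub>R k)) k))
        (at t within {0..s})" if "a \<in> {0..s}" "t \<in> {0..s}" for a t
    proof -
      have "x + (a *\<^sub>R h + t *\<^sub>R k) \<in> S"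
        using dist[OF that] small(2) by (intro subsetD[OF d2]) (simp only: mem_ball dv le_less_trans)
      then have "((\<lambda>t. f (x + (a *\<^sub>R h + t *\<^sub>R k))) has_derivative (\<lambda>r. f' (x + (a *\<^sub>R h + t *\<^sub>R k)) (r *\<^sub>R k)))
          (at t within {0..s})"
        by (intro has_derivative_compose[OF _ f, where f = "\<lambda>t. x + (a *\<^sub>R h + t *\<^sub>R k)"])
          (auto intro!: derivative_eq_intros)
      then show ?thesis by (simp add: blinfun.scaleR_right)
    qed
    have dq: "(q has_derivative (\<lambda>r. r *\<^sub>R q' t)) (at t within {0..s})" if "t \<in> {0..s}" for t
      unfolding q_def q'_def
      by (rule has_derivative_eq_rhs[OF has_derivative_diff[OF has_derivative_diff[OF
              der[of s t] der[of 0 t]] has_derivative_scaleR_left[OF has_derivative_ident]]])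
        (use that \<open>0 < s\<close> in \<open>auto simp: algebra_simps\<close>)
    have near: "norm (f' (x + (a *\<^sub>R h + t *\<^sub>R k)) - f' x - f'' (a *\<^sub>R h + t *\<^sub>R k)) \<le> \<eta> * (s * D)"
      if "a \<in> {0..s}" "t \<in> {0..s}" for a t
    proof -
      have "norm (f' (x + (a *\<^sub>R h + t *\<^sub>R k)) - f' x - f'' (a *\<^sub>R h + t *\<^sub>R k))
          \<le> \<eta> * norm (a *\<^sub>R h + t *\<^sub>R k)"
        using d1[of "x + (a *\<^sub>R h + t *\<^sub>R k)"] dist[OF that] small(1) by simp
      also have "\<dots> \<le> \<eta> * (s * D)"
        using dist[OF that] \<open>\<eta> > 0\<close> by (intro mult_left_mono) auto
      finally show ?thesis .
    qed
    have "norm (q' t) \<le> 2 * (\<eta> * (s * D)) * norm k" if t: "t \<in> {0..s}" for t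
    proof -
      let ?E = "\<lambda>a. f' (x + (a *\<^sub>R h + t *\<^sub>R k)) - f' x - f'' (a *\<^sub>R h + t *\<^sub>R k)"
      have "q' t = (?E s - ?E 0) k"
        by (simp add: q'_def blinfun.diff_left blinfun.add_left blinfun.add_right blinfun.scaleR_right
            blinfun.scaleR_left)
      then have "norm (q' t) \<le> norm (?E s - ?E 0) * norm k"
        by (simp only: norm_blinfun)
      also have "\<dots> \<le> (norm (?E s) + norm (?E 0)) * norm k"
        by (intro mult_right_mono norm_triangle_ineq4) auto
      also have "\<dots> \<le> (\<eta> * (s * D) + \<eta> * (s * D)) * norm k"
        using t \<open>0 < s\<close> by (intro mult_right_mono add_mono near) auto
      finally show ?thesis by (simp add: mult_ac)
    qed
    then have "onorm (\<lambda>r. r *\<^sub>R q' t) \<le> 2 * (\<eta> * (s * D)) * norm k" if "t \<in> {0..s}" for t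
      using that by (intro onorm_le) (metis mult.commute mult_right_mono norm_ge_zero norm_scaleR real_norm_def)
    then have "norm (q s - q 0) \<le> 2 * (\<eta> * (s * D)) * norm k * norm (s - 0)"
      using \<open>0 < s\<close> by (intro differentiable_bound[OF _ dq]) auto
    also have "\<dots> \<le> 2 * (\<eta> * (s * D)) * D * norm (s - 0)"
      using \<open>0 < s\<close> \<open>\<eta> > 0\<close> \<open>D \<ge> 0\<close> by (intro mult_right_mono mult_left_mono) (auto simp: D_def)
    also have "\<dots> = \<eta> * (2 * (D * D)) * (s * s)"
      using \<open>0 < s\<close> by simp
    also have "\<dots> \<le> e * (s * s)"
    proof (intro mult_right_mono)
      have "\<eta> * (2 * (D * D)) \<le> \<eta> * (2 * (D * D) + 1)"
        using \<open>\<eta> > 0\<close> by (intro mult_left_mono) auto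
      also have "\<dots> = e"
        using add_nonneg_pos[of "2 * (D * D)" 1] by (simp add: \<eta>_def less_imp_neq[symmetric])
      finally show "\<eta> * (2 * (D * D)) \<le> e" .
    qed simp
    finally show ?thesis
      by (simp add: q_def algebra_simps)
  qed
  with \<open>d > 0\<close> show ?thesis by blast
qed

text \<open>
  The second difference \<open>f(x + s h + s k) - f(x + s h) - f(x + s k) + f(x)\<close> is symmetric in \<open>h\<close> and \<open>k\<close>, and
  both \<open>s\<^sup>2 f''(h)(k)\<close> and \<open>s\<^sup>2 f''(k)(h)\<close> approximate it up to \<open>o(s\<^sup>2)\<close>.
\<close>

theorem second_derivative_symmetric:
  fixes f :: "'a::real_normed_vector \<Rightarrow> 'b::real_normed_vector"
    and f' :: "'a \<Rightarrow> 'a \<Rightarrow>\<^sub>L 'b" and f'' :: "'a \<Rightarrow>\<^sub>L 'a \<Rightarrow>\<^sub>L 'b"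
  assumes "open S" "x \<in> S"
    and "\<And>y. y \<in> S \<Longrightarrow> (f has_derivative f' y) (at y)"
    and "(f' has_derivative f'') (at x)"
  shows "f'' h k = f'' k h"
proof -
  have "norm (f'' h k - f'' k h) \<le> 0 + e" if "e > 0" for e
  proof -
    have "e / 2 > 0" using that by simp
    note bound = second_difference_bound[OF assms this]
    obtain d1 where d1: "d1 > 0" "\<And>s. 0 < s \<Longrightarrow> s < d1 \<Longrightarrow>
        norm (f (x + s *\<^sub>R h + s *\<^sub>R k) - f (x + s *\<^sub>R h) - f (x + s *\<^sub>R k) + f x - (s * s) *\<^sub>R f'' h k) \<le> e / 2 * (s * s)"
      using bound[of h k] by blast
    obtain d2 where d2: "d2 > 0" "\<And>s. 0 < s \<Longrightarrow> s < d2 \<Longrightarrow>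
        norm (f (x + s *\<^sub>R k + s *\<^sub>R h) - f (x + s *\<^sub>R k) - f (x + s *\<^sub>R h) + f x - (s * s) *\<^sub>R f'' k h) \<le> e / 2 * (s * s)"
      using bound[of k h] by blast
    define s where "s = min d1 d2 / 2"
    define \<Delta> where "\<Delta> = f (x + s *\<^sub>R h + s *\<^sub>R k) - f (x + s *\<^sub>R h) - f (x + s *\<^sub>R k) + f x"
    have s: "0 < s" "s < d1" "s < d2" using d1(1) d2(1) by (auto simp: s_def)
    have "norm (\<Delta> - (s * s) *\<^sub>R f'' k h) \<le> e / 2 * (s * s)"
      using d2(2)[of s] s by (simp add: \<Delta>_def algebra_simps)
    moreover have "norm (\<Delta> - (s * s) *\<^sub>R f'' h k) \<le> e / 2 * (s * s)"
      using d1(2)[of s] s by (simp add: \<Delta>_def)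
    ultimately have "norm ((\<Delta> - (s * s) *\<^sub>R f'' k h) - (\<Delta> - (s * s) *\<^sub>R f'' h k))
        \<le> e / 2 * (s * s) + e / 2 * (s * s)"
      using norm_triangle_ineq4 order.trans add_mono by meson
    also have "(\<Delta> - (s * s) *\<^sub>R f'' k h) - (\<Delta> - (s * s) *\<^sub>R f'' h k) = (s * s) *\<^sub>R (f'' h k - f'' k h)"
      by (simp add: algebra_simps)
    finally have "(s * s) * norm (f'' h k - f'' k h) \<le> (s * s) * e"
      by (simp add: mult_ac)
    then show ?thesis using s(1) by simp
  qed
  then have "norm (f'' h k - f'' k h) \<le> 0" by (rule field_le_epsilon)
  then show ?thesis by simp
qed

text \<open>
  The Leibniz rule for an outer product of the vectors \<open>P(y) e\<^sub>k\<close> with \<open>k \<in> S\<close>, where the differentiated factor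
  has been moved to the front; \<open>blade_sign {k} S\<close> is the sign of that move, as it counts the elements
  of \<open>S\<close> before \<open>k\<close>.
\<close>

lemma has_derivative_outermorphism_blade:
  fixes P :: "'a::real_normed_vector \<Rightarrow> 'n::{finite,linorder} point \<Rightarrow>\<^sub>L 'm::{finite,linorder} point"
  assumes "(P has_derivative P') (at x)"
  shows "((\<lambda>y. outermorphism (P y) (blade S)) has_derivative
    (\<lambda>h. \<Sum>k\<in>S. blade_sign {k} S *\<^sub>R
      (gvec (P' h (axis k 1)) \<curlywedge> outermorphism (P x) (blade (S - {k}))))) (at x)"
proof (induction S rule: finite_linorder_min_induct[OF finite])
  case 1
  then show ?case by (simp add: outermorphism_one)
next
  case (2 b S)
  then have "b \<notin> S" by blast
  let ?u = "\<lambda>y k. gvec (P y (axis k 1))"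
  let ?w = "\<lambda>h k. gvec (P' h (axis k 1))"
  have "bounded_linear (\<lambda>A :: 'n point \<Rightarrow>\<^sub>L 'm point. gvec (A (axis b 1)))"
    using bounded_linear_compose[OF linear_gvec[unfolded linear_conv_bounded_linear]
        blinfun.bounded_linear_left] .
  then have "((\<lambda>y. ?u y b) has_derivative (\<lambda>h. ?w h b)) (at x)"
    using assms by (rule bounded_linear.has_derivative)
  then have "((\<lambda>y. ?u y b \<curlywedge> outermorphism (P y) (blade S)) has_derivative
    (\<lambda>h. ?u x b \<curlywedge> (\<Sum>k\<in>S. blade_sign {k} S *\<^sub>R (?w h k \<curlywedge> outermorphism (P x) (blade (S - {k}))))
      + ?w h b \<curlywedge> outermorphism (P x) (blade S))) (at x)"
    using 2(3) by (rule outer.FDERIV)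
  also have "(\<lambda>y. ?u y b \<curlywedge> outermorphism (P y) (blade S)) = (\<lambda>y. outermorphism (P y) (blade (insert b S)))"
    using 2(2) by (simp add: outermorphism_insert_min)
  finally show ?case
  proof (rule has_derivative_eq_rhs, intro ext)
    fix h
    have sgn: "blade_sign {k} (insert b S) = - blade_sign {k} S" if "k \<in> S" for k
      using that \<open>b \<notin> S\<close> 2(2) by (auto simp: blade_sign_def)
    have "?u x b \<curlywedge> (blade_sign {k} S *\<^sub>R (?w h k \<curlywedge> outermorphism (P x) (blade (S - {k}))))
        = blade_sign {k} (insert b S) *\<^sub>R (?w h k \<curlywedge> outermorphism (P x) (blade (insert b S - {k})))"
      if k: "k \<in> S" for k
    proof -
      have eq: "insert b S - {k} = insert b (S - {k})"
        using k \<open>b \<notin> S\<close> by blast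
      have "?u x b \<curlywedge> (?w h k \<curlywedge> outermorphism (P x) (blade (S - {k})))
          = - (?w h k \<curlywedge> (?u x b \<curlywedge> outermorphism (P x) (blade (S - {k}))))"
        using outer_gvec_anticommute[of "P x (axis b 1)" "P' h (axis k 1)"]
        by (simp add: outer.minus_left flip: outer_assoc)
      also have "?u x b \<curlywedge> outermorphism (P x) (blade (S - {k})) = outermorphism (P x) (blade (insert b S - {k}))"
        unfolding eq using 2(2) by (simp add: outermorphism_insert_min)
      finally show ?thesis
        by (simp add: outer.scaleR_right sgn k)
    qed
    moreover have "blade_sign {b} (insert b S) = 1"
      using 2(2) by (auto simp: blade_sign_def intro!: prod.neutral)
    ultimately show "?u x b \<curlywedge> (\<Sum>k\<in>S. blade_sign {k} S *\<^sub>R (?w h k \<curlywedge> outermorphism (P x) (blade (S - {k}))))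
        + ?w h b \<curlywedge> outermorphism (P x) (blade S)
      = (\<Sum>k\<in>insert b S. blade_sign {k} (insert b S) *\<^sub>R
          (?w h k \<curlywedge> outermorphism (P x) (blade (insert b S - {k}))))"
      using \<open>b \<notin> S\<close> by (simp add: outer.sum_right add.commute)
  qed
qed

lemma alternating_sum_symmetric:
  fixes c :: "'i \<Rightarrow> 'i \<Rightarrow> real" and T :: "'i \<Rightarrow> 'i \<Rightarrow> 'b::real_vector"
  assumes "\<And>i k. c i k = - c k i" "\<And>i k. T i k = T k i"
  shows "(\<Sum>i\<in>I. \<Sum>k\<in>I. c i k *\<^sub>R T i k) = 0"
proof -
  have "(\<Sum>i\<in>I. \<Sum>k\<in>I. c i k *\<^sub>R T i k) = (\<Sum>i\<in>I. \<Sum>k\<in>I. - (c k i *\<^sub>R T k i))"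
    by (intro sum.cong refl) (metis assms scaleR_minus_left)
  also have "\<dots> = - (\<Sum>i\<in>I. \<Sum>k\<in>I. c i k *\<^sub>R T i k)"
    by (subst sum.swap) (simp add: sum_negf)
  finally show ?thesis
    by (simp add: eq_neg_iff_add_eq_0 flip: scaleR_2)
qed

text \<open>
  Whether \<open>e\<^sub>i\<close> or \<open>e\<^sub>k\<close> is removed first from \<open>v\<close> makes a difference of one transposition.
\<close>

lemma blade_sign_face_alternating:
  fixes i k :: "'n::{finite,linorder}"
  assumes "i \<noteq> k"
  shows "blade_sign UNIV {i} * blade_sign {k} (UNIV - {i})
    = - (blade_sign UNIV {k} * blade_sign {i} (UNIV - {k}))"
proof -
  define \<kappa> :: real where "\<kappa> = (- 1) ^ (CARD('n) - 1)"
  have 1: "blade_sign UNIV {j} = \<kappa> * blade_sign {j} UNIV" for j :: 'n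
    using blade_sign_UNIV_mult[of j] blade_sign_square[of "{j}" UNIV]
    by (metis \<kappa>_def mult.assoc mult.right_neutral)
  have 2: "blade_sign {a} (UNIV - {b}) = blade_sign {a} UNIV * blade_sign {a} {b}" for a b :: 'n
    using blade_sign_Un_right[of "UNIV - {b}" "{b}" "{a}"] blade_sign_square[of "{a}" "{b}"]
    by (simp add: mult.assoc)
  have "blade_sign {i} {k} = - blade_sign {k} {i}"
    using assms by (auto simp: blade_sign_def)
  then show ?thesis
    by (simp add: 1 2 mult_ac)
qed

text \<open>
  By the Leibniz rule the divergence is a double sum over \<open>i \<noteq> k\<close> of a sign times
  \<open>\<partial>\<^sub>i\<partial>\<^sub>kf \<and> (\<And>\<^bsub>j\<noteq>i,k\<^esub> \<partial>\<^sub>jf)\<close>; the sign is alternating in \<open>i, k\<close> and the other factor is symmetric.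
  The derivatives are handed out together with the identity for use in the product rule.
\<close>

theorem hypersurface_tangent_divergence_free:
  fixes f :: "'n::{finite,linorder} point \<Rightarrow> 'm::{finite,linorder} point"
    and f' :: "'n point \<Rightarrow> 'n point \<Rightarrow>\<^sub>L 'm point"
  assumes "open S" "x \<in> S"
    and "\<And>y. y \<in> S \<Longrightarrow> (f has_derivative f' y) (at y)"
    and "(f' has_derivative blinfun_apply f'') (at x)"
  obtains D where
    "\<And>i. ((\<lambda>y. outermorphism (f' y) (hypersurface_tangent (axis i 1))) has_derivative D i) (at x)"
    "(\<Sum>i\<in>UNIV. D i (axis i 1)) = 0"
proof -
  define T where "T i k = gvec (f'' (axis i 1) (axis k 1))
    \<curlywedge> outermorphism (f' x) (blade (UNIV - {i} - {k}))" for i k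
  define D where "D i h = blade_sign UNIV {i} *\<^sub>R (\<Sum>k\<in>UNIV - {i}. blade_sign {k} (UNIV - {i}) *\<^sub>R
      (gvec (f'' h (axis k 1)) \<curlywedge> outermorphism (f' x) (blade (UNIV - {i} - {k}))))" for i h
  have "((\<lambda>y. outermorphism (f' y) (hypersurface_tangent (axis i 1))) has_derivative D i) (at x)" for i
    unfolding hypersurface_tangent_axis outermorphism_scaleR D_def
    by (intro has_derivative_scaleR_right has_derivative_outermorphism_blade assms)
  moreover have "(\<Sum>i\<in>UNIV. D i (axis i 1)) = 0"
  proof -
    define c where
      "c i k = (if k = i then 0 else blade_sign UNIV {i} * blade_sign {k} (UNIV - {i}))" for i k :: 'n
    have D: "D i (axis i 1) = (\<Sum>k\<in>UNIV. c i k *\<^sub>R T i k)" for i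
    proof -
      have "D i (axis i 1) = (\<Sum>k\<in>UNIV - {i}. c i k *\<^sub>R T i k)"
        by (simp add: D_def c_def T_def scaleR_sum_right)
      also have "\<dots> = (\<Sum>k\<in>UNIV. c i k *\<^sub>R T i k)"
        by (rule sum.mono_neutral_left) (auto simp: c_def)
      finally show ?thesis .
    qed
    have c: "c i k = - c k i" for i k
      using blade_sign_face_alternating[of i k] by (auto simp: c_def)
    have T: "T i k = T k i" for i k
      using second_derivative_symmetric[OF assms, of "axis i 1" "axis k 1"]
      by (simp add: T_def Diff_insert2 [symmetric] insert_commute flip: Diff_insert)
    show ?thesis
      unfolding D by (rule alternating_sum_symmetric) (fact c T)+
  qed
  ultimately show thesis by (rule that)
qed

section \<open>Integrals over shrinking cubes\<close>

lemma set_integral_near_const: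
  fixes f :: "'a::t2_space \<Rightarrow> 'b::{banach,second_countable_topology}"
  assumes sets: "sets \<mu> = sets borel" and "compact K" and fin: "emeasure \<mu> K < \<infinity>"
    and f: "continuous_on K f" and near: "\<And>x. x \<in> K \<Longrightarrow> norm (f x - a) \<le> B"
  shows "set_integrable \<mu> K f"
    and "norm ((LINT x:K|\<mu>. f x) - measure \<mu> K *\<^sub>R a) \<le> B * measure \<mu> K"
proof -
  have K: "K \<in> sets \<mu>"
    using assms(2) sets by (simp add: borel_compact)
  have "norm (f x) \<le> B + norm a" if "x \<in> K" for x
    using near[OF that] norm_triangle_ineq2[of "f x" a] by linarith
  moreover have "(\<lambda>x. indicator K x *\<^sub>R f x) \<in> borel_measurable \<mu>"
    using borel_measurable_continuous_on_indicator[OF _ f] assms(2) sets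
    by (simp add: borel_compact cong: measurable_cong_sets)
  ultimately show int: "set_integrable \<mu> K f"
    unfolding set_integrable_def using K fin
    by (intro integrableI_bounded_set[where A = K and B = "B + norm a"]) auto
  have const: "set_integrable \<mu> K (\<lambda>_. c)" for c :: "'c::{banach,second_countable_topology}"
    unfolding set_integrable_def using K fin by simp
  have "(LINT x:K|\<mu>. f x) - measure \<mu> K *\<^sub>R a = (LINT x:K|\<mu>. f x - a)"
    using int const[of a] fin K
    by (simp add: set_integral_diff) (simp add: set_lebesgue_integral_def)
  also have "norm \<dots> \<le> (LINT x:K|\<mu>. norm (f x - a))"
    using set_integral_norm_bound[OF set_integral_diff(1)[OF int const[of a]]] .
  also have "\<dots> \<le> (LINT x:K|\<mu>. B)"
    using set_integrable_norm[OF set_integral_diff(1)[OF int const[of a]]] const near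
    by (intro set_integral_mono) auto
  also have "\<dots> = B * measure \<mu> K"
    using fin K by (simp add: set_lebesgue_integral_def)
  finally show "norm ((LINT x:K|\<mu>. f x) - measure \<mu> K *\<^sub>R a) \<le> B * measure \<mu> K" .
qed

subsection \<open>The measure of a face\<close>

lemma sets_hyperplane_volume: "sets (hyperplane_volume i t) = sets borel"
  by (simp add: hyperplane_volume_def)

lemma measurable_hyperplane_embedding:
  "(\<lambda>y. \<chi> j. if j = i then t else y j) \<in> Pi\<^sub>M (UNIV - {i}) (\<lambda>_. lborel) \<rightarrow>\<^sub>M (borel :: ('n::finite point) measure)"
proof (subst borel_measurable_euclidean_space, intro ballI)
  fix b :: "'n point" assume "b \<in> Basis"
  then obtain k where k: "b = axis k 1" by (auto simp: Basis_vec_def)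
  show "(\<lambda>y. (\<chi> j. if j = i then t else y j) \<bullet> b) \<in> borel_measurable (Pi\<^sub>M (UNIV - {i}) (\<lambda>_. lborel))"
  proof (cases "k = i")
    case False
    then have "(\<lambda>y. y k) \<in> Pi\<^sub>M (UNIV - {i}) (\<lambda>_. lborel :: real measure) \<rightarrow>\<^sub>M lborel"
      by (intro measurable_component_singleton) auto
    with False show ?thesis by (simp add: k inner_axis cong: measurable_cong_sets)
  qed (simp add: k inner_axis)
qed

text \<open>
  Pulling the integral over a face back to the opposite face turns a difference of two integrals into
  an integral of a difference of values, to which differentiability applies.
\<close>

lemma hyperplane_volume_translate:
  "hyperplane_volume i (t + s) = distr (hyperplane_volume i t) borel (\<lambda>x. x + s *\<^sub>R axis i 1)"
proof -
  have "(\<lambda>x. x + s *\<^sub>R axis i 1) \<circ> (\<lambda>y. \<chi> j. if j = i then t else y j)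
      = (\<lambda>y. \<chi> j. if j = i then t + s else y j)"
    by (auto simp: fun_eq_iff vec_eq_iff axis_def)
  then show ?thesis
    unfolding hyperplane_volume_def
    by (subst distr_distr) (auto intro: measurable_hyperplane_embedding)
qed

lemma closed_face: "closed {x \<in> cbox a b. x $ i = (t::real)}" for a b :: "'n::finite point"
  using closed_Int[OF closed_cbox closed_Collect_eq[of "\<lambda>x. x $ i" "\<lambda>_. t"]]
  by (simp add: Collect_conj_eq continuous_intros)

lemma mem_cube: "x \<in> cbox p (p + s *\<^sub>R 1) \<longleftrightarrow> (\<forall>j. p $ j \<le> x $ j \<and> x $ j \<le> p $ j + s)"
  by (simp add: mem_box_cart)

lemma mem_face:
  assumes "p $ i \<le> t" "t \<le> p $ i + s"
  shows "x \<in> {x \<in> cbox p (p + s *\<^sub>R 1). x $ i = t} \<longleftrightarrow>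
    x $ i = t \<and> (\<forall>j. j \<noteq> i \<longrightarrow> p $ j \<le> x $ j \<and> x $ j \<le> p $ j + s)"
  unfolding mem_Collect_eq mem_cube using assms by metis

lemma emeasure_face:
  fixes p :: "'n::finite point"
  assumes "0 \<le> s" "p $ i \<le> t" "t \<le> p $ i + s"
  shows "emeasure (hyperplane_volume i t) {x \<in> cbox p (p + s *\<^sub>R 1). x $ i = t} = ennreal (s ^ (CARD('n) - 1))"
proof -
  let ?K = "{x \<in> cbox p (p + s *\<^sub>R 1). x $ i = t}"
  let ?M = "Pi\<^sub>M (UNIV - {i}) (\<lambda>_. lborel :: real measure)"
  interpret product_sigma_finite "\<lambda>_::'n. lborel :: real measure"
    by (simp add: product_sigma_finite_def sigma_finite_lborel)
  have "emeasure (hyperplane_volume i t) ?K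
      = emeasure ?M ((\<lambda>y. \<chi> j. if j = i then t else y j) -` ?K \<inter> space ?M)"
    unfolding hyperplane_volume_def
    by (intro emeasure_distr measurable_hyperplane_embedding borel_closed closed_face)
  also have "(\<lambda>y. \<chi> j. if j = i then t else y j) -` ?K \<inter> space ?M
      = (\<Pi>\<^sub>E j\<in>UNIV - {i}. {p $ j .. p $ j + s})"
    by (intro set_eqI) (simp only: vimage_eq Int_iff mem_face[OF assms(2,3)], auto simp: space_PiM PiE_iff)
  also have "emeasure ?M \<dots> = (\<Prod>j\<in>UNIV - {i}. ennreal s)"
    using assms(1) by (subst emeasure_PiM) auto
  also have "\<dots> = ennreal (s ^ (CARD('n) - 1))"
    using assms(1) by (simp add: card_Diff_singleton ennreal_power)
  finally show ?thesis .
qed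

lemma integral_opposite_face:
  fixes p :: "'n::finite point" and G :: "'n point \<Rightarrow> 'b::{banach,second_countable_topology}"
  assumes "0 < s" "continuous_on (cbox p (p + s *\<^sub>R 1)) G"
  shows "(LINT x:{x \<in> cbox p (p + s *\<^sub>R 1). x $ i = p $ i + s}|hyperplane_volume i (p $ i + s). G x)
    = (LINT x:{x \<in> cbox p (p + s *\<^sub>R 1). x $ i = p $ i}|hyperplane_volume i (p $ i). G (x + s *\<^sub>R axis i 1))"
proof -
  let ?K = "{x \<in> cbox p (p + s *\<^sub>R 1). x $ i = p $ i + s}"
  let ?K' = "{x \<in> cbox p (p + s *\<^sub>R 1). x $ i = p $ i}"
  have "(\<lambda>x. indicator ?K x *\<^sub>R G x) \<in> borel_measurable borel"
    using assms(2)
    by (intro borel_measurable_continuous_on_indicator borel_closed closed_face)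
      (auto elim: continuous_on_subset)
  moreover have "(\<lambda>x. x + s *\<^sub>R axis i 1) \<in> hyperplane_volume i (p $ i) \<rightarrow>\<^sub>M borel"
    by (simp cong: measurable_cong_sets add: sets_hyperplane_volume)
  moreover have "x + s *\<^sub>R axis i 1 \<in> ?K \<longleftrightarrow> x \<in> ?K'" for x
    using assms(1) by (subst (1 2) mem_face) (auto simp: axis_def)
  then have "indicator ?K (x + s *\<^sub>R axis i 1) = (indicator ?K' x :: real)" for x
    by (simp only: indicator_def)
  ultimately show ?thesis
    unfolding set_lebesgue_integral_def hyperplane_volume_translate by (subst integral_distr) simp_all
qed

lemma measure_cube:
  fixes p :: "'n::finite point"
  assumes "0 \<le> s"
  shows "measure lborel (cbox p (p + s *\<^sub>R 1)) = s ^ CARD('n)"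
proof -
  have "cbox p (p + s *\<^sub>R 1) \<noteq> {}"
    using assms by (auto simp: mem_cube intro!: exI[of _ p] simp flip: ex_in_conv)
  then have "Henstock_Kurzweil_Integration.content (cbox p (p + s *\<^sub>R 1)) = s ^ CARD('n)"
    by (simp add: content_cbox_cart)
  then show ?thesis by simp
qed

lemma interval_bounds_cube:
  fixes p :: "'n::finite point"
  assumes "0 \<le> s"
  shows "interval_upperbound (cbox p (p + s *\<^sub>R 1)) = p + s *\<^sub>R 1"
    "interval_lowerbound (cbox p (p + s *\<^sub>R 1)) = p"
  using assms by (auto simp: Basis_vec_def inner_axis intro!: interval_upperbound interval_lowerbound)

text \<open>
  Differentiability controls errors by the distance to \<open>x\<close>; this bounds them by the side of the cube, which
  is what compares with its volume.
\<close>

lemma norm_diff_cube: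
  fixes p :: "'n::finite point"
  assumes "x \<in> cbox p (p + s *\<^sub>R 1)" "y \<in> cbox p (p + s *\<^sub>R 1)"
  shows "norm (x - y) \<le> real CARD('n) * s"
proof -
  have "\<bar>x $ j - y $ j\<bar> \<le> s" for j
    using assms[unfolded mem_cube, rule_format, of j] by linarith
  then have "(\<Sum>j\<in>UNIV. \<bar>(x - y) $ j\<bar>) \<le> (\<Sum>j\<in>(UNIV :: 'n set). s)"
    by (intro sum_mono) simp
  then show ?thesis
    using norm_le_l1_cart[of "x - y"] by simp
qed

subsection \<open>Limits along shrinking cubes\<close>

lemma eventually_shrinking_cubes:
  "eventually P (shrinking_cubes x) \<longleftrightarrow>
    (\<exists>r>0. \<forall>c. closed_cube c \<and> c \<subseteq> cbox 0 1 \<and> x \<in> c \<and> diameter c < r \<longrightarrow> P c)"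
  unfolding shrinking_cubes_def
  by (subst eventually_INF_base) (auto simp: eventually_principal intro!: bexI[of _ "min _ _"])

lemma eventually_shrinking_cubesI:
  assumes "0 < r"
    and "\<And>p s. 0 < s \<Longrightarrow> x \<in> cbox p (p + s *\<^sub>R 1) \<Longrightarrow> cbox p (p + s *\<^sub>R 1) \<subseteq> ball x r \<Longrightarrow>
      P (cbox p (p + s *\<^sub>R 1))"
  shows "eventually P (shrinking_cubes x)"
  unfolding eventually_shrinking_cubes
proof (intro exI[of _ r] conjI allI impI assms(1); elim conjE)
  fix c assume c: "closed_cube c" "x \<in> c" "diameter c < r"
  then obtain p s where ps: "0 < s" "c = cbox p (p + s *\<^sub>R 1)"
    by (auto simp: closed_cube_def)
  then have "dist x y < r" if "y \<in> c" for y
    using diameter_bounded_bound[of c x y] c that by auto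
  then have "c \<subseteq> ball x r" by auto
  then show "P c" using assms(2)[of s p] ps c(2) by simp
qed

lemma shrinking_cubes_neq_bot:
  fixes x :: "'n::finite point"
  assumes "x \<in> box 0 1"
  shows "shrinking_cubes x \<noteq> bot"
proof
  assume "shrinking_cubes x = bot"
  then have "eventually (\<lambda>_. False) (shrinking_cubes x)" by simp
  then obtain r where "r > 0" and r: "\<And>c. closed_cube c \<Longrightarrow> c \<subseteq> cbox 0 1 \<Longrightarrow> x \<in> c \<Longrightarrow> \<not> diameter c < r"
    unfolding eventually_shrinking_cubes by blast
  obtain e where "e > 0" and e: "ball x e \<subseteq> box 0 1"
    using assms open_box open_contains_ball by blast
  define s where "s = min r e / (2 * real CARD('n))"
  let ?c = "cbox x (x + s *\<^sub>R 1)"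
  have s: "0 < s" "real CARD('n) * s < r" "real CARD('n) * s < e"
    using \<open>r > 0\<close> \<open>e > 0\<close> by (auto simp: s_def)
  then have x: "x \<in> ?c" by (simp add: mem_cube)
  have "?c \<subseteq> ball x e"
    using norm_diff_cube[OF x] s(3) by (force simp: dist_norm)
  then have "?c \<subseteq> cbox 0 1"
    using e box_subset_cbox by blast
  moreover have "diameter ?c \<le> real CARD('n) * s"
    using norm_diff_cube x by (intro diameter_le) auto
  moreover have "closed_cube ?c" using s(1) by (auto simp: closed_cube_def)
  ultimately show False using r x s(2) by force
qed

lemma norm_average_le:
  fixes a :: "'b::real_normed_vector"
  assumes "norm (v - V *\<^sub>R a) \<le> e * V" "V > 0"
  shows "norm ((1 / V) *\<^sub>R v - a) \<le> e"
proof -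
  have "(1 / V) *\<^sub>R v - a = (1 / V) *\<^sub>R (v - V *\<^sub>R a)"
    using assms(2) by (simp add: scaleR_diff_right)
  then show ?thesis
    using assms by (simp add: pos_divide_le_eq)
qed

lemma average_tendsto:
  fixes f :: "'n::finite point \<Rightarrow> 'b::{banach,second_countable_topology}"
  assumes "open U" "x \<in> U" "continuous_on U f"
  shows "((\<lambda>c. (1 / measure lborel c) *\<^sub>R (LINT x:c|lborel. f x)) \<longlongrightarrow> f x) (shrinking_cubes x)"
proof (rule tendstoI)
  fix e :: real assume "e > 0"
  then have "e / 2 > 0" by simp
  then obtain d where "d > 0" and d: "\<And>y. dist y x < d \<Longrightarrow> norm (f y - f x) < e / 2"
    using assms by (metis continuous_on_eq_continuous_at continuous_at_eps_delta dist_norm)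
  obtain r where "r > 0" and r: "ball x r \<subseteq> U"
    using assms(1,2) open_contains_ball by blast
  show "eventually (\<lambda>c. dist ((1 / measure lborel c) *\<^sub>R (LINT x:c|lborel. f x)) (f x) < e) (shrinking_cubes x)"
  proof (rule eventually_shrinking_cubesI[of "min d r"])
    fix p :: "'n point" and s
    let ?c = "cbox p (p + s *\<^sub>R 1)"
    assume s: "0 < s" and c: "?c \<subseteq> ball x (min d r)"
    have pos: "measure lborel ?c > 0" using s by (simp add: measure_cube del: measure_lborel_cbox_eq)
    have "norm ((LINT x:?c|lborel. f x) - measure lborel ?c *\<^sub>R f x) \<le> e / 2 * measure lborel ?c"
    proof (rule set_integral_near_const)
      show "continuous_on ?c f" using assms(3) c r by (force intro: continuous_on_subset)
      show "norm (f y - f x) \<le> e / 2" if "y \<in> ?c" for y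
        using d[of y] c that by (force simp: dist_commute)
    qed (simp_all add: emeasure_lborel_cbox_eq)
    then have "dist ((1 / measure lborel ?c) *\<^sub>R (LINT x:?c|lborel. f x)) (f x) \<le> e / 2"
      unfolding dist_norm using pos by (rule norm_average_le)
    then show "dist ((1 / measure lborel ?c) *\<^sub>R (LINT x:?c|lborel. f x)) (f x) < e"
      using \<open>e > 0\<close> by linarith
  qed (use \<open>d > 0\<close> \<open>r > 0\<close> in simp)
qed

text \<open>The contribution of the pair of faces with normals \<open>\<plusminus>e\<^sub>i\<close> to a boundary integral whose integrand is
  odd in the normal.\<close>

definition face_flux :: "'n::finite \<Rightarrow> ('n point \<Rightarrow> 'b::{banach,second_countable_topology}) \<Rightarrow> 'n point set \<Rightarrow> 'b" where
  "face_flux i G c =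
     (let t = interval_upperbound c $ i in LINT x:{x\<in>c. x $ i = t}|hyperplane_volume i t. G x) -
     (let t = interval_lowerbound c $ i in LINT x:{x\<in>c. x $ i = t}|hyperplane_volume i t. G x)"

text \<open>
  At opposite points \<open>y\<close> and \<open>y + s e\<^sub>i\<close> of the two faces, \<open>G(y + s e\<^sub>i) - G(y) = s G'(e\<^sub>i) + o(s)\<close> uniformly,
  since both points are within \<open>n s\<close> of \<open>x\<close>.  Integrating over a face, of volume \<open>s\<^sup>n\<^sup>-\<^sup>1\<close>, gives
  \<open>s\<^sup>n G'(e\<^sub>i) + o(s\<^sup>n)\<close>.
\<close>

theorem face_flux_tendsto:
  fixes G :: "'n::finite point \<Rightarrow> 'b::{banach,second_countable_topology}"
  assumes "open U" "x \<in> U" "continuous_on U G" "(G has_derivative G') (at x)"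
  shows "((\<lambda>c. (1 / measure lborel c) *\<^sub>R face_flux i G c) \<longlongrightarrow> G' (axis i 1)) (shrinking_cubes x)"
proof (rule tendstoI)
  fix e :: real assume "e > 0"
  define N where "N = real CARD('n)"
  have "N > 0" by (simp add: N_def)
  \<comment> \<open>Two error terms, each at most \<open>\<eta> N s\<close>, then add up to \<open>e s / 2\<close>.\<close>
  define \<eta> where "\<eta> = e / (4 * N)"
  have "\<eta> > 0" using \<open>e > 0\<close> \<open>N > 0\<close> by (simp add: \<eta>_def)
  then obtain d where "d > 0" and d: "\<And>y. norm (y - x) < d \<Longrightarrow>
      norm (G y - G x - G' (y - x)) \<le> \<eta> * norm (y - x)"
    using assms(4) by (auto simp: has_derivative_at_alt)
  have linG': "linear G'"
    using assms(4) has_derivative_linear by blast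
  obtain r where "r > 0" and r: "ball x r \<subseteq> U"
    using assms(1,2) open_contains_ball by blast
  show "eventually (\<lambda>c. dist ((1 / measure lborel c) *\<^sub>R face_flux i G c) (G' (axis i 1)) < e) (shrinking_cubes x)"
  proof (rule eventually_shrinking_cubesI[of "min d r"])
    fix p :: "'n point" and s
    let ?c = "cbox p (p + s *\<^sub>R 1)"
    assume s: "0 < s" and x: "x \<in> ?c" and c: "?c \<subseteq> ball x (min d r)"
    define \<mu> where "\<mu> = hyperplane_volume i (p $ i)"
    define K where "K = {x \<in> ?c. x $ i = p $ i}"
    define a where "a = s *\<^sub>R G' (axis i 1)"
    let ?shift = "\<lambda>y. y + s *\<^sub>R axis i 1"
    have shift: "?shift y \<in> ?c" if "y \<in> K" for y
      using that s by (auto simp: K_def mem_cube axis_def)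
    have cont: "continuous_on ?c G"
      using assms(3) c r by (force intro: continuous_on_subset)
    have "compact K"
      unfolding K_def compact_eq_bounded_closed
      by (intro conjI closed_face bounded_subset[OF bounded_cbox, of _ p "p + s *\<^sub>R 1"]) auto
    have sets: "sets \<mu> = sets borel" by (simp add: \<mu>_def sets_hyperplane_volume)
    have em: "emeasure \<mu> K = ennreal (s ^ (CARD('n) - 1))"
      using s emeasure_face[of s p i "p $ i"] by (simp add: \<mu>_def K_def)
    then have meas: "measure \<mu> K = s ^ (CARD('n) - 1)"
      using s by (simp add: measure_def)
    have fin: "emeasure \<mu> K < \<infinity>" by (simp add: em)
    have contK: "continuous_on K G"
      using cont by (rule continuous_on_subset) (auto simp: K_def)
    have contK': "continuous_on K (\<lambda>y. G (?shift y))"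
      using cont shift by (intro continuous_on_compose2[OF cont]) (auto intro!: continuous_intros)
    have "\<exists>B. \<forall>y\<in>K. norm (f y - 0) \<le> B" if "continuous_on K f" for f :: "'n point \<Rightarrow> 'b"
      using compact_imp_bounded[OF compact_continuous_image[OF that \<open>compact K\<close>]]
      by (auto simp: bounded_iff)
    then have int: "set_integrable \<mu> K f" if "continuous_on K f" for f :: "'n point \<Rightarrow> 'b"
      using set_integral_near_const(1)[OF sets \<open>compact K\<close> fin that] that by blast
    have flux: "face_flux i G ?c = (LINT y:K|\<mu>. G (?shift y) - G y)"
      using integral_opposite_face[OF s cont, of i] s
      by (simp add: face_flux_def interval_bounds_cube set_integral_diff(2)[OF int[OF contK'] int[OF contK]]
          flip: \<mu>_def K_def)
    have "norm (G (?shift y) - G y - a) \<le> 2 * (\<eta> * (N * s))" if y: "y \<in> K" for y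
    proof -
      let ?E = "\<lambda>y. G y - G x - G' (y - x)"
      have E: "norm (?E z) \<le> \<eta> * (N * s)" if "z \<in> ?c" for z
      proof -
        have "norm (z - x) < d" using that c by (auto simp: dist_norm norm_minus_commute)
        then have "norm (?E z) \<le> \<eta> * norm (z - x)" by (rule d)
        also have "\<dots> \<le> \<eta> * (N * s)"
          using norm_diff_cube[OF that x] \<open>\<eta> > 0\<close> by (intro mult_left_mono) (auto simp: N_def)
        finally show ?thesis .
      qed
      have "G (?shift y) - G y - a = ?E (?shift y) - ?E y"
        by (simp add: a_def linear_diff[OF linG'] linear_add[OF linG'] linear_scale[OF linG'])
      also have "norm \<dots> \<le> norm (?E (?shift y)) + norm (?E y)"
        by (rule norm_triangle_ineq4)
      also have "\<dots> \<le> \<eta> * (N * s) + \<eta> * (N * s)"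
        using E[OF shift[OF y]] E[of y] y by (intro add_mono) (auto simp: K_def)
      finally show ?thesis by (simp add: mult_ac)
    qed
    moreover have "continuous_on K (\<lambda>y. G (?shift y) - G y)"
      using contK contK' by (intro continuous_intros)
    ultimately have "norm (face_flux i G ?c - measure \<mu> K *\<^sub>R a) \<le> 2 * (\<eta> * (N * s)) * measure \<mu> K"
      unfolding flux by (intro set_integral_near_const(2) sets fin \<open>compact K\<close>)
    moreover have pow: "s ^ (CARD('n) - 1) * s = s ^ CARD('n)"
      by (metis power_minus_mult zero_less_card_finite)
    ultimately have "norm (face_flux i G ?c - s ^ CARD('n) *\<^sub>R G' (axis i 1)) \<le> e / 2 * s ^ CARD('n)"
      using \<open>N > 0\<close> by (simp add: meas a_def \<eta>_def mult_ac flip: pow)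
    then have "norm ((1 / s ^ CARD('n)) *\<^sub>R face_flux i G ?c - G' (axis i 1)) \<le> e / 2"
      using s by (intro norm_average_le) auto
    then show "dist ((1 / measure lborel ?c) *\<^sub>R face_flux i G ?c) (G' (axis i 1)) < e"
      using \<open>e > 0\<close> s by (simp only: measure_cube dist_norm less_imp_le)
  qed (use \<open>d > 0\<close> \<open>r > 0\<close> in simp)
qed

section \<open>The tangential derivative\<close>

lemma C2_singular_cube_derivatives:
  fixes \<phi> :: "'n::{finite,linorder} point \<Rightarrow> 'm::{finite,linorder} point"
  assumes "C2_singular_cube \<phi>"
  obtains f' :: "'n point \<Rightarrow> 'n point \<Rightarrow>\<^sub>L 'm point" and f''
  where "\<And>x. x \<in> box 0 1 \<Longrightarrow> (\<phi> has_derivative f' x) (at x)"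
    "\<And>x. x \<in> box 0 1 \<Longrightarrow> (f' has_derivative blinfun_apply (f'' x)) (at x)"
    "\<And>x A. x \<in> box 0 1 \<Longrightarrow> differential \<phi> x A = outermorphism (f' x) A"
proof -
  obtain f' :: "'n point \<Rightarrow> 'n point \<Rightarrow>\<^sub>L 'm point" and f''
    where 1: "\<And>x. x \<in> box 0 1 \<Longrightarrow> (\<phi> has_derivative f' x) (at x)"
    and 2: "\<And>x. x \<in> box 0 1 \<Longrightarrow> (f' has_derivative blinfun_apply (f'' x)) (at x)"
    using assms unfolding C2_singular_cube_def C2_on_def by blast
  have "differential \<phi> x A = outermorphism (f' x) A" if "x \<in> box 0 1" for x A
    using frechet_derivative_at[OF 1[OF that]] by (simp add: differential_def)
  with 1 2 show thesis by (rule that)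
qed

lemma continuous_on_differential_blade:
  fixes \<phi> :: "'n::{finite,linorder} point \<Rightarrow> 'm::{finite,linorder} point"
  assumes "C2_singular_cube \<phi>"
  shows "continuous_on (box 0 1) (\<lambda>x. differential \<phi> x (blade S))"
proof -
  obtain f' :: "'n point \<Rightarrow> 'n point \<Rightarrow>\<^sub>L 'm point" and f''
    where "\<And>x. x \<in> box 0 1 \<Longrightarrow> (\<phi> has_derivative f' x) (at x)"
    and f'': "\<And>x. x \<in> box 0 1 \<Longrightarrow> (f' has_derivative blinfun_apply (f'' x)) (at x)"
    and eq: "\<And>x A. x \<in> box 0 1 \<Longrightarrow> differential \<phi> x A = outermorphism (f' x) A"
    by (rule C2_singular_cube_derivatives[OF assms]) blast
  have "continuous_on (box 0 1) (\<lambda>x. outermorphism (f' x) (blade S))"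
    by (intro continuous_at_imp_continuous_on ballI)
      (rule has_derivative_continuous[OF has_derivative_outermorphism_blade[OF f'']])
  then show ?thesis by (simp add: eq cong: continuous_on_cong)
qed

lemma differential_scaleR: "differential \<phi> x (r *\<^sub>R A) = r *\<^sub>R differential \<phi> x A"
  by (simp add: differential_def outermorphism_scaleR)

lemma differential_minus: "differential \<phi> x (- A) = - differential \<phi> x A"
  by (simp add: differential_def outermorphism_minus)

lemma differential_sum: "differential \<phi> x (\<Sum>i\<in>I. A i) = (\<Sum>i\<in>I. differential \<phi> x (A i))"
  by (simp add: differential_def linear_sum[OF linear_outermorphism])

lemma jacobian_average_tendsto:
  assumes "C2_singular_cube \<phi>" "x \<in> box 0 1"
  shows "((\<lambda>c. image_volume \<phi> c / measure lborel c) \<longlongrightarrow> jacobian \<phi> x) (shrinking_cubes x)"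
proof -
  have "continuous_on (box 0 1) (jacobian \<phi>)"
    unfolding jacobian_def unit_pseudoscalar_eq_blade
    by (intro continuous_on_norm continuous_on_differential_blade assms)
  from average_tendsto[OF open_box assms(2) this] show ?thesis
    by (simp add: image_volume_def)
qed

lemma directed_boundary_integral_eq_face_flux:
  "directed_boundary_integral \<phi> F c =
    (\<Sum>i\<in>UNIV. face_flux i (\<lambda>x. differential \<phi> x (hypersurface_tangent (axis i 1)) \<odot> F (\<phi> x)) c)"
  unfolding directed_boundary_integral_def boundary_integral_def face_flux_def Let_def
  by (intro sum.cong refl)
    (simp add: hypersurface_tangent_minus differential_minus gprod.minus_left set_lebesgue_integral_def)

lemma chain_partial_eq:
  assumes "(F \<circ> \<phi> has_derivative D) (at x)"
  shows "chain_partial \<phi> F x i = D (axis i 1)"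
proof -
  have "((\<lambda>t. x + t *\<^sub>R axis i 1) has_derivative (\<lambda>t. t *\<^sub>R axis i 1)) (at (0::real))"
    by (auto intro!: derivative_eq_intros)
  then have "((\<lambda>t. (F \<circ> \<phi>) (x + t *\<^sub>R axis i 1)) has_derivative (\<lambda>t. D (t *\<^sub>R axis i 1))) (at 0)"
    using assms by (intro has_derivative_compose[of _ _ 0 UNIV "F \<circ> \<phi>" D]) simp_all
  then have "((\<lambda>t. (F \<circ> \<phi>) (x + t *\<^sub>R axis i 1)) has_vector_derivative D (axis i 1)) (at 0)"
    using linear_scale[OF has_derivative_linear[OF assms]] by (simp add: has_vector_derivative_def)
  then show ?thesis
    unfolding chain_partial_def by (rule vector_derivative_at)
qed

text \<open>
  Stated with \<open>F \<circ> \<phi>\<close> differentiable only on a neighbourhood \<open>U\<close> of \<open>x\<close>, so that it also applies to a second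
  parametrization \<open>\<psi>\<close>, along which \<open>F\<close> is known to be differentiable only near the point in question.
\<close>

theorem directed_boundary_integral_tendsto:
  fixes \<phi> :: "'n::{finite,linorder} point \<Rightarrow> 'm::{finite,linorder} point" and F :: "'m point \<Rightarrow> 'm multivector"
  assumes \<phi>: "C2_singular_cube \<phi>" and U: "open U" "x \<in> U" "U \<subseteq> box 0 1"
    and F: "\<And>y. y \<in> U \<Longrightarrow> (F \<circ> \<phi>) differentiable (at y)"
  shows "((\<lambda>c. (1 / measure lborel c) *\<^sub>R directed_boundary_integral \<phi> F c) \<longlongrightarrow>
    (\<Sum>i\<in>UNIV. differential \<phi> x (hypersurface_tangent (axis i 1)) \<odot> chain_partial \<phi> F x i))
    (shrinking_cubes x)"
proof -
  define A where "A i y = differential \<phi> y (hypersurface_tangent (axis i 1))" for i y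
  have x: "x \<in> box 0 1" using U by blast
  obtain Df where Df: "(F \<circ> \<phi> has_derivative Df) (at x)"
    using F[OF U(2)] by (auto simp: differentiable_def)
  obtain f' :: "'n point \<Rightarrow> 'n point \<Rightarrow>\<^sub>L 'm point" and f''
    where f': "\<And>x. x \<in> box 0 1 \<Longrightarrow> (\<phi> has_derivative f' x) (at x)"
    and f'': "\<And>x. x \<in> box 0 1 \<Longrightarrow> (f' has_derivative blinfun_apply (f'' x)) (at x)"
    and eq: "\<And>x A. x \<in> box 0 1 \<Longrightarrow> differential \<phi> x A = outermorphism (f' x) A"
    by (rule C2_singular_cube_derivatives[OF \<phi>]) blast
  obtain D where D: "\<And>i. ((\<lambda>y. outermorphism (f' y) (hypersurface_tangent (axis i 1))) has_derivative D i) (at x)"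
    and div: "(\<Sum>i\<in>UNIV. D i (axis i 1)) = 0"
    by (rule hypersurface_tangent_divergence_free[OF open_box x f' f''[OF x]]) blast+
  have A: "(A i has_derivative D i) (at x)" for i
    by (rule has_derivative_transform_within_open[OF D open_box x]) (simp add: A_def eq)
  have "continuous_on U (A i)" for i
    unfolding A_def hypersurface_tangent_axis differential_scaleR
    by (intro continuous_intros continuous_on_subset[OF continuous_on_differential_blade[OF \<phi>] U(3)])
  moreover have "continuous_on U (F \<circ> \<phi>)"
    using F by (intro continuous_at_imp_continuous_on ballI differentiable_imp_continuous_within)
  ultimately have cont: "continuous_on U (\<lambda>y. A i y \<odot> (F \<circ> \<phi>) y)" for i
    by (rule gprod.continuous_on)
  have "((\<lambda>y. A i y \<odot> (F \<circ> \<phi>) y) has_derivative (\<lambda>h. A i x \<odot> Df h + D i h \<odot> (F \<circ> \<phi>) x)) (at x)" for i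
    using A Df by (rule gprod.FDERIV)
  then have "((\<lambda>c. (1 / measure lborel c) *\<^sub>R face_flux i (\<lambda>y. A i y \<odot> (F \<circ> \<phi>) y) c) \<longlongrightarrow>
      A i x \<odot> Df (axis i 1) + D i (axis i 1) \<odot> (F \<circ> \<phi>) x) (shrinking_cubes x)" for i
    by (rule face_flux_tendsto[OF U(1,2) cont])
  then have "((\<lambda>c. \<Sum>i\<in>UNIV. (1 / measure lborel c) *\<^sub>R face_flux i (\<lambda>y. A i y \<odot> (F \<circ> \<phi>) y) c) \<longlongrightarrow>
      (\<Sum>i\<in>UNIV. A i x \<odot> Df (axis i 1) + D i (axis i 1) \<odot> (F \<circ> \<phi>) x)) (shrinking_cubes x)"
    by (intro tendsto_sum)
  moreover have "(\<Sum>i\<in>UNIV. A i x \<odot> Df (axis i 1) + D i (axis i 1) \<odot> (F \<circ> \<phi>) x)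
      = (\<Sum>i\<in>UNIV. A i x \<odot> Df (axis i 1))"
    using div by (simp add: sum.distrib gprod.zero_left flip: gprod.sum_left)
  ultimately show ?thesis
    by (simp add: directed_boundary_integral_eq_face_flux A_def chain_partial_eq[OF Df] scaleR_sum_right)
qed

lemma eventually_cube_measure_pos: "eventually (\<lambda>c. measure lborel c > 0) (shrinking_cubes x)"
  by (rule eventually_shrinking_cubesI[of 1]) (simp_all only: measure_cube less_imp_le zero_less_power zero_less_one)

text \<open>
  Only the ratio \<open>|C| / |c|\<close>, the average of the Jacobian over \<open>c\<close>, separates the two densities.
\<close>

theorem boundary_density_tendsto:
  assumes "C2_singular_cube \<phi>" "x \<in> box 0 1"
    and "((\<lambda>c. (1 / measure lborel c) *\<^sub>R directed_boundary_integral \<phi> F c) \<longlongrightarrow> L) (shrinking_cubes x)"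
  shows "(boundary_density \<phi> F \<longlongrightarrow> (1 / jacobian \<phi> x) *\<^sub>R L) (shrinking_cubes x)"
proof -
  have "jacobian \<phi> x \<noteq> 0"
    using assms(1,2) by (force simp: C2_singular_cube_def)
  then have "((\<lambda>c. (1 / (image_volume \<phi> c / measure lborel c)) *\<^sub>R
      ((1 / measure lborel c) *\<^sub>R directed_boundary_integral \<phi> F c)) \<longlongrightarrow> (1 / jacobian \<phi> x) *\<^sub>R L)
      (shrinking_cubes x)"
    by (intro tendsto_scaleR tendsto_divide tendsto_const jacobian_average_tendsto assms)
  then show ?thesis
  proof (rule Lim_transform_eventually)
    show "eventually (\<lambda>c. (1 / (image_volume \<phi> c / measure lborel c)) *\<^sub>R
      ((1 / measure lborel c) *\<^sub>R directed_boundary_integral \<phi> F c) = boundary_density \<phi> F c) (shrinking_cubes x)"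
      using eventually_cube_measure_pos[of x]
      by eventually_elim (simp add: boundary_density_def)
  qed
qed

lemma tangential_derivative_eqI:
  assumes "x \<in> box 0 1" "(boundary_density \<phi> F \<longlongrightarrow> (1 / jacobian \<phi> x) *\<^sub>R L) (shrinking_cubes x)"
  shows "tangential_derivative \<phi> F x = ((1 / jacobian \<phi> x) *\<^sub>R greverse (tangent \<phi> x)) \<odot> L"
  using tendsto_Lim[OF shrinking_cubes_neq_bot[OF assms(1)] assms(2)]
  by (simp add: tangential_derivative_def gprod.scaleR_left gprod.scaleR_right)

subsection \<open>Invariance under coordinate changes\<close>

text \<open>
  All three quantities transform by powers of \<open>det g'\<close>: the Jacobian and the sum by its first power, the
  unit tangent by its sign, which is positive.  Hence their combination in the tangential derivative
  is unchanged.
\<close>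

theorem coordinate_change:
  fixes \<phi> \<psi> :: "'n::{finite,linorder} point \<Rightarrow> 'm::{finite,linorder} point" and F :: "'m point \<Rightarrow> 'm multivector"
  assumes g: "(g has_derivative g') (at y)" "det (matrix g') > 0"
    and \<phi>: "(\<phi> has_derivative \<phi>') (at (g y))" "(F \<circ> \<phi> has_derivative Df) (at (g y))"
    and \<psi>: "(\<psi> has_derivative \<phi>' \<circ> g') (at y)" "(F \<circ> \<psi> has_derivative Df \<circ> g') (at y)"
  shows "jacobian \<psi> y = det (matrix g') * jacobian \<phi> (g y)" "tangent \<psi> y = tangent \<phi> (g y)"
    "(\<Sum>i\<in>UNIV. differential \<psi> y (hypersurface_tangent (axis i 1)) \<odot> chain_partial \<psi> F y i)
      = det (matrix g') *\<^sub>R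
        (\<Sum>i\<in>UNIV. differential \<phi> (g y) (hypersurface_tangent (axis i 1)) \<odot> chain_partial \<phi> F (g y) i)"
proof -
  let ?d = "det (matrix g')"
  have lin: "linear g'" "linear \<phi>'" "linear Df"
    using assms by (auto intro: has_derivative_linear)
  have comp: "differential \<psi> y A = differential \<phi> (g y) (outermorphism g' A)" for A
    using frechet_derivative_at[OF \<psi>(1)] frechet_derivative_at[OF \<phi>(1)] outermorphism_compose[OF lin(2,1)]
    by (simp add: differential_def o_def)
  have ps: "differential \<psi> y unit_pseudoscalar = ?d *\<^sub>R differential \<phi> (g y) unit_pseudoscalar"
    by (simp add: comp unit_pseudoscalar_eq_blade outermorphism_pseudoscalar[OF lin(1)] differential_scaleR)
  then show jac: "jacobian \<psi> y = ?d * jacobian \<phi> (g y)"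
    using g(2) by (simp add: jacobian_def)
  show "tangent \<psi> y = tangent \<phi> (g y)"
    using g(2) by (simp add: tangent_def ps jac)
  have "Df (g' (axis i 1)) = (\<Sum>j\<in>UNIV. (g' (axis i 1) $ j) *\<^sub>R Df (axis j 1))" for i
    using linear_sum[OF lin(3), of "\<lambda>j. (g' (axis i 1) $ j) *\<^sub>R axis j 1" UNIV] basis_expansion[of "g' (axis i 1)"]
    by (simp add: linear_scale[OF lin(3)] scalar_mult_eq_scaleR)
  then have "(\<Sum>i\<in>UNIV. differential \<psi> y (hypersurface_tangent (axis i 1)) \<odot> chain_partial \<psi> F y i)
      = (\<Sum>i\<in>UNIV. \<Sum>j\<in>UNIV. (g' (axis i 1) $ j) *\<^sub>R
          (differential \<psi> y (hypersurface_tangent (axis i 1)) \<odot> Df (axis j 1)))"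
    by (simp add: chain_partial_eq[OF \<psi>(2)] gprod.sum_right gprod.scaleR_right)
  also have "\<dots> = (\<Sum>j\<in>UNIV. differential \<phi> (g y)
      (\<Sum>i\<in>UNIV. (g' (axis i 1) $ j) *\<^sub>R outermorphism g' (hypersurface_tangent (axis i 1))) \<odot> Df (axis j 1))"
    by (subst sum.swap) (simp add: comp differential_sum differential_scaleR gprod.sum_left gprod.scaleR_left)
  also have "\<dots> = ?d *\<^sub>R (\<Sum>j\<in>UNIV. differential \<phi> (g y) (hypersurface_tangent (axis j 1)) \<odot> Df (axis j 1))"
    using g(2) by (simp add: outermorphism_hypersurface_tangent[OF lin(1)] differential_scaleR gprod.scaleR_left
        scaleR_sum_right)
  finally show "(\<Sum>i\<in>UNIV. differential \<psi> y (hypersurface_tangent (axis i 1)) \<odot> chain_partial \<psi> F y i)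
      = ?d *\<^sub>R (\<Sum>i\<in>UNIV. differential \<phi> (g y) (hypersurface_tangent (axis i 1)) \<odot> chain_partial \<phi> F (g y) i)"
    by (simp add: chain_partial_eq[OF \<phi>(2)])
qed

lemma same_oriented_parametrizationE:
  assumes "same_oriented_parametrization \<phi> x \<psi> y"
  obtains U g where "open U" "y \<in> U" "U \<subseteq> box 0 1" "g y = x" "\<And>z. z \<in> U \<Longrightarrow> g z \<in> box 0 1"
    "\<And>z. z \<in> U \<Longrightarrow> \<psi> z = \<phi> (g z)" "\<And>z. z \<in> U \<Longrightarrow> g differentiable (at z)"
    "det (matrix (frechet_derivative g (at y))) > 0"
proof -
  obtain U W where y: "\<psi> y = \<phi> x" "y \<in> U" "U \<subseteq> box 0 1" and W: "x \<in> W" "W \<subseteq> box 0 1" "inj_on \<phi> W"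
    and img: "\<psi> ` U = \<phi> ` W"
    and ch: "orientation_preserving_coordinate_change U W (the_inv_into W \<phi> \<circ> \<psi>)"
    using assms unfolding same_oriented_parametrization_def by blast
  define g where "g = the_inv_into W \<phi> \<circ> \<psi>"
  have 1: "g z \<in> box 0 1" "\<psi> z = \<phi> (g z)" if "z \<in> U" for z
  proof -
    have "\<psi> z \<in> \<phi> ` W" using that img by blast
    then show "g z \<in> box 0 1" "\<psi> z = \<phi> (g z)"
      using the_inv_into_into[OF W(3), of "\<psi> z" W] f_the_inv_into_f[OF W(3), of "\<psi> z"] W(2)
      by (auto simp: g_def)
  qed
  have 2: "g y = x"
    using the_inv_into_f_f[OF W(3,1)] y(1) by (simp add: g_def)
  have 3: "g differentiable (at z)" if "z \<in> U" for z
    using that ch unfolding orientation_preserving_coordinate_change_def C2_on_def g_def[symmetric]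
    by (meson differentiableI)
  have "open U" "det (matrix (frechet_derivative g (at y))) > 0"
    using ch y(2) by (simp_all add: orientation_preserving_coordinate_change_def flip: g_def)
  with that y(2,3) 1 2 3 show thesis by blast
qed

theorem tangential_derivative_invariant:
  fixes \<phi> \<psi> :: "'n::{finite,linorder} point \<Rightarrow> 'm::{finite,linorder} point" and F :: "'m point \<Rightarrow> 'm multivector"
  assumes \<phi>: "C2_singular_cube \<phi>" "x \<in> box 0 1" "\<And>z. z \<in> box 0 1 \<Longrightarrow> (F \<circ> \<phi>) differentiable (at z)"
    and \<psi>: "C2_singular_cube \<psi>" "y \<in> box 0 1" and same: "same_oriented_parametrization \<phi> x \<psi> y"
  shows "tangential_derivative_exists \<psi> F y" "tangential_derivative \<psi> F y = tangential_derivative \<phi> F x"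
proof -
  obtain U g where U: "open U" "y \<in> U" "U \<subseteq> box 0 1" and gy: "g y = x"
    and g01: "\<And>z. z \<in> U \<Longrightarrow> g z \<in> box 0 1" and eq: "\<And>z. z \<in> U \<Longrightarrow> \<psi> z = \<phi> (g z)"
    and dg: "\<And>z. z \<in> U \<Longrightarrow> g differentiable (at z)"
    and det: "det (matrix (frechet_derivative g (at y))) > 0"
    using same_oriented_parametrizationE[OF same] by metis
  have comp: "(H \<circ> \<psi> has_derivative H' \<circ> g') (at z)"
    if "z \<in> U" "(g has_derivative g') (at z)" "(H \<circ> \<phi> has_derivative H') (at (g z))"
    for z g' and H :: "'m point \<Rightarrow> 'b::real_normed_vector" and H'
    by (rule has_derivative_transform_within_open[OF diff_chain_at[OF that(2,3)] U(1) that(1)])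
      (simp add: eq)
  have F\<psi>: "(F \<circ> \<psi>) differentiable (at z)" if "z \<in> U" for z
    using comp[OF that, of _ F] dg[OF that] \<phi>(3)[OF g01[OF that]] unfolding differentiable_def by blast
  let ?S = "\<lambda>\<phi> x. \<Sum>i\<in>UNIV. differential \<phi> x (hypersurface_tangent (axis i 1)) \<odot> chain_partial \<phi> F x i"
  have lim\<psi>: "(boundary_density \<psi> F \<longlongrightarrow> (1 / jacobian \<psi> y) *\<^sub>R ?S \<psi> y) (shrinking_cubes y)"
    by (intro boundary_density_tendsto directed_boundary_integral_tendsto[of \<psi> U] \<psi> U F\<psi>)
  then show "tangential_derivative_exists \<psi> F y"
    unfolding tangential_derivative_exists_def by blast
  have lim\<phi>: "(boundary_density \<phi> F \<longlongrightarrow> (1 / jacobian \<phi> x) *\<^sub>R ?S \<phi> x) (shrinking_cubes x)"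
    by (intro boundary_density_tendsto directed_boundary_integral_tendsto[of \<phi> "box 0 1"] \<phi> open_box order_refl)
  obtain \<phi>' where \<phi>': "(\<phi> has_derivative \<phi>') (at (g y))"
    using C2_singular_cube_derivatives[OF \<phi>(1)] \<phi>(2) gy by metis
  obtain Df where Df: "(F \<circ> \<phi> has_derivative Df) (at (g y))"
    using \<phi>(3)[OF \<phi>(2)] gy by (auto simp: differentiable_def)
  define g' where "g' = frechet_derivative g (at y)"
  have g': "(g has_derivative g') (at y)"
    using dg[OF U(2)] by (simp add: g'_def frechet_derivative_works)
  note change = coordinate_change[OF g' det[folded g'_def] \<phi>' Df
      comp[OF U(2) g', of id \<phi>', simplified, OF \<phi>'] comp[OF U(2) g' Df]]
  show "tangential_derivative \<psi> F y = tangential_derivative \<phi> F x"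
    unfolding tangential_derivative_eqI[OF \<psi>(2) lim\<psi>] tangential_derivative_eqI[OF \<phi>(2) lim\<phi>]
    unfolding change gy using det by (simp add: g'_def gprod.scaleR_left gprod.scaleR_right)
qed

section \<open>Existence, formula and invariance\<close>

lemma hypersurface_tangent_eq_outer_list:
  fixes i :: "'n::{finite,linorder}"
  shows "hypersurface_tangent (axis i 1) = (- 1) ^ card {j. i < j} *\<^sub>R
    outer_list (map (\<lambda>j. gvec (axis j 1)) (sorted_list_of_set (UNIV - {i})))"
proof -
  have "blade_sign UNIV {i} = (\<Prod>s\<in>UNIV. if i < s then - 1 else 1)"
    by (simp add: blade_sign_def)
  also have "\<dots> = (- 1) ^ card {j. i < j}"
    by (simp add: prod.If_cases)
  finally have "blade_sign UNIV {i} = (- 1) ^ card {j. i < j}" .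
  moreover have "blade (UNIV - {i}) = outer_list (map (\<lambda>j. gvec (axis j 1)) (sorted_list_of_set (UNIV - {i})))"
    using outermorphism_blade[of "\<lambda>x. x" "UNIV - {i}"] by (simp add: outermorphism_id)
  ultimately show ?thesis by (simp add: hypersurface_tangent_axis)
qed

theorem mainTheorem3:
  fixes M :: "('n::{finite,linorder}, 'm::{finite,linorder}) chain"
    and F :: "'m point \<Rightarrow> 'm multivector"
  assumes "C2_chain M"
    and "differentiable_on_chain F M"
  shows "(\<forall>\<phi>\<in>Poly_Mapping.keys M. \<forall>x\<^sub>0\<in>box 0 1.
      tangential_derivative_exists \<phi> F x\<^sub>0 \<and>
      (\<exists>L. ((\<lambda>c. (1 / measure lborel c) *\<^sub>R directed_boundary_integral \<phi> F c) \<longlongrightarrow> L)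
             (shrinking_cubes x\<^sub>0) \<and>
           tangential_derivative \<phi> F x\<^sub>0 =
             ((1 / jacobian \<phi> x\<^sub>0) *\<^sub>R greverse (tangent \<phi> x\<^sub>0)) \<odot> L) \<and>
      (\<forall>\<psi> y\<^sub>0. C2_singular_cube \<psi> \<and> y\<^sub>0 \<in> box 0 1 \<and> same_oriented_parametrization \<phi> x\<^sub>0 \<psi> y\<^sub>0 \<longrightarrow>
        tangential_derivative_exists \<psi> F y\<^sub>0 \<and>
        tangential_derivative \<psi> F y\<^sub>0 = tangential_derivative \<phi> F x\<^sub>0) \<and>
      tangential_derivative \<phi> F x\<^sub>0 =
        (\<Sum>i\<in>UNIV. (1 / jacobian \<phi> x\<^sub>0) *\<^sub>R
           (greverse (tangent \<phi> x\<^sub>0) \<odot> differential \<phi> x\<^sub>0 (hypersurface_tangent (axis i 1)) \<odot>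
            chain_partial \<phi> F x\<^sub>0 i))) \<and>
    (\<forall>i::'n. hypersurface_tangent (axis i 1) = (- 1) ^ card {j. i < j} *\<^sub>R
      outer_list (map (\<lambda>j. gvec (axis j 1)) (sorted_list_of_set (UNIV - {i}))))"
proof (intro conjI ballI allI)
  fix \<phi> and x :: "'n point" assume \<phi>M: "\<phi> \<in> Poly_Mapping.keys M" and x: "x \<in> box 0 1"
  have \<phi>: "C2_singular_cube \<phi>" and F: "\<And>z. z \<in> box 0 1 \<Longrightarrow> (F \<circ> \<phi>) differentiable (at z)"
    using assms \<phi>M by (auto simp: C2_chain_def differentiable_on_chain_def)
  define L where "L = (\<Sum>i\<in>UNIV. differential \<phi> x (hypersurface_tangent (axis i 1)) \<odot> chain_partial \<phi> F x i)"
  have lim: "((\<lambda>c. (1 / measure lborel c) *\<^sub>R directed_boundary_integral \<phi> F c) \<longlongrightarrow> L) (shrinking_cubes x)"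
    unfolding L_def by (intro directed_boundary_integral_tendsto[of \<phi> "box 0 1"] \<phi> x F open_box order_refl)
  note density = boundary_density_tendsto[OF \<phi> x lim]
  show "tangential_derivative_exists \<phi> F x"
    unfolding tangential_derivative_exists_def using density by blast
  have value_eq: "tangential_derivative \<phi> F x = ((1 / jacobian \<phi> x) *\<^sub>R greverse (tangent \<phi> x)) \<odot> L"
    using x density by (rule tangential_derivative_eqI)
  with lim show "\<exists>L. ((\<lambda>c. (1 / measure lborel c) *\<^sub>R directed_boundary_integral \<phi> F c) \<longlongrightarrow> L) (shrinking_cubes x) \<and>
      tangential_derivative \<phi> F x = ((1 / jacobian \<phi> x) *\<^sub>R greverse (tangent \<phi> x)) \<odot> L"
    by blast
  show "tangential_derivative \<phi> F x =
      (\<Sum>i\<in>UNIV. (1 / jacobian \<phi> x) *\<^sub>R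
         (greverse (tangent \<phi> x) \<odot> differential \<phi> x (hypersurface_tangent (axis i 1)) \<odot> chain_partial \<phi> F x i))"
    by (simp add: value_eq L_def gprod.sum_right gprod.scaleR_left gprod_assoc scaleR_sum_right)
  fix \<psi> :: "'n point \<Rightarrow> 'm point" and y
  show "C2_singular_cube \<psi> \<and> y \<in> box 0 1 \<and> same_oriented_parametrization \<phi> x \<psi> y \<longrightarrow>
      tangential_derivative_exists \<psi> F y \<and> tangential_derivative \<psi> F y = tangential_derivative \<phi> F x"
    using tangential_derivative_invariant[OF \<phi> x F] by blast
qed (rule hypersurface_tangent_eq_outer_list)

end
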